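(* Let $n\ge3$, $\mu\in\mathbb{R}^n$, $\sigma>0$, and let $x_1<\dots<x_n$ be real numbers. Let $y=\mu+\xi$ with $\xi\sim\mathcal{N}(0,\sigma^2I_{n\times n})$. Then for any $x>0$, the estimator $\hat\mu=\hat\mu^{LS}(\mathcal{K}^C_{x_1,\dots,x_n})$ satisfies $$\|\hat\mu-\mu\|^2\le\min_{u\in\mathcal{K}^C_{x_1,\dots,x_n}}\left(\|u-\mu\|^2+\frac{16\sigma^2q(u)}{n}\log\frac{en}{q(u)}\right)+\frac{4\sigma^2x}{n}$$ with probability greater than $1-\exp(-x)$.
   Context: Scaled norm: $\|v\|^2=\frac1n\sum_{i=1}^n v_i^2$ for $v\in\mathbb{R}^n$. $\mathcal{K}^C_{x_1,\dots,x_n}=\left\{u\in\mathbb{R}^n:\ \frac{u_i-u_{i-1}}{x_i-x_{i-1}}\le\frac{u_{i+1}-u_i}{x_{i+1}-x_i},\ i=2,\dots,n-1\right\}$. For $u\in\mathcal{K}^C_{x_1,\dots,x_n}$, $u$ is piecewise affine with $k$ pieces if there exist real numbers $a_1,\dots,a_k$ and a partition $(T_1,\dots,T_k)$ of $\{1,\dots,n\}$ such that $u_i=a_j(x_i-x_l)+u_l$ for all $i,l\in T_j$ and all $j=1,\dots,k$; $q(u)\ge1$ is the smallest integer such that $u$ is piecewise affine with $q(u)$ pieces. The least squares estimator over a nonempty closed set $K$ is $\hat\mu^{LS}(K)\in\operatorname{argmin}_{v\in K}\|y-v\|^2$. *)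

theory Defs
  imports "HOL-Probability.Probability"
begin

text \<open>
  A vector of \<open>\<real>\<^sup>n\<close> is a function of type \<^typ>\<open>nat \<Rightarrow> real\<close>, of which only the values at
  \<open>1, \<dots>, n\<close> matter. Members of \<open>convex_seqs\<close> are normalised to be \<open>undefined\<close> outside
  \<open>{1..n}\<close>, so that this set is in bijection with the cone in \<open>\<real>\<^sup>n\<close>, and the least squares
  estimator over it is unique.
\<close>

definition scaled_norm_sq :: "nat \<Rightarrow> (nat \<Rightarrow> real) \<Rightarrow> real" where
  "scaled_norm_sq n v = (1 / real n) * (\<Sum>i=1..n. (v i)\<^sup>2)"

definition convex_seqs :: "nat \<Rightarrow> (nat \<Rightarrow> real) \<Rightarrow> (nat \<Rightarrow> real) set" where
  "convex_seqs n x = {u \<in> {1..n} \<rightarrow>\<^sub>E UNIV.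
     \<forall>i\<in>{2..n - 1}. (u i - u (i - 1)) / (x i - x (i - 1)) \<le> (u (i + 1) - u i) / (x (i + 1) - x i)}"

definition piecewise_affine :: "nat \<Rightarrow> (nat \<Rightarrow> real) \<Rightarrow> (nat \<Rightarrow> real) \<Rightarrow> nat \<Rightarrow> bool" where
  "piecewise_affine n x u k \<longleftrightarrow>
     (\<exists>(a :: nat \<Rightarrow> real) (T :: nat \<Rightarrow> nat set).
        inj_on T {1..k} \<and> partition_on {1..n} (T ` {1..k}) \<and>
        (\<forall>j\<in>{1..k}. \<forall>i\<in>T j. \<forall>l\<in>T j. u i = a j * (x i - x l) + u l))"

definition num_pieces :: "nat \<Rightarrow> (nat \<Rightarrow> real) \<Rightarrow> (nat \<Rightarrow> real) \<Rightarrow> nat" where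
  "num_pieces n x u = (LEAST k. k \<ge> 1 \<and> piecewise_affine n x u k)"

definition least_squares :: "nat \<Rightarrow> (nat \<Rightarrow> real) set \<Rightarrow> (nat \<Rightarrow> real) \<Rightarrow> (nat \<Rightarrow> real)" where
  "least_squares n K y = arg_min (\<lambda>v. scaled_norm_sq n (\<lambda>i. y i - v i)) (\<lambda>v. v \<in> K)"

end

theory Submission
  imports Defs "HOL-Combinatorics.Multiset_Permutations" "HOL-Library.Sublist"
begin

text \<open>
  The variational inequality for the projection bounds the excess loss, multiplied by \<open>n\<close>, by
  \<open>\<Sum>i. 2 \<xi>\<^sub>i w\<^sub>i - w\<^sub>i\<^sup>2\<close> with \<open>w\<close> the difference of the estimator and \<open>u\<close>. On a piece \<open>T\<close> of \<open>u\<close> the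
  sequence \<open>w\<close> is convex (whether or not \<open>T\<close> is an interval), hence antitone and then monotone.
  So \<open>exp\<close> of this excess divided by \<open>4\<sigma>\<^sup>2\<close> is at most a product over the pieces of sums, over the position
  of the minimum, of exponentials of the gains of two monotone cones on disjoint sets of indices.

  For a monotone cone on \<open>k\<close> points, the gain is \<open>\<Sum>\<^sub>B (\<Sum>i\<in>B. \<xi>\<^sub>i)\<^sup>2 / |B|\<close> over the blocks \<open>B\<close> of the greatest
  convex minorant of the partial sums. Averaging over all orderings of the points and applying the
  cycle lemma to each block, as in Spitzer's identity, replaces the random blocks by a sum over all
  set partitions with weights \<open>\<Prod>\<^sub>B (|B| - 1)!\<close>. As \<open>E exp (N\<^sup>2/4) = \<surd>2 \<le> 2\<close> for standard normal \<open>N\<close>, the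
  exponential moment is at most \<open>k + 1\<close>. AM-GM over the pieces and Markov's inequality finish the
  proof, with room to spare for the strict inequality and for a near-minimiser in place of the minimiser.
\<close>

section \<open>Gains of monotone cones\<close>

text \<open>For distinct \<open>xs\<close> this is the squared norm of the projection of
  \<open>g\<close> onto the monotone cone. Encoding the cone by a list makes reversal give the
  antitone cone and permutation a relabelling of the noise.\<close>

definition monotone_gain :: "('i \<Rightarrow> real) \<Rightarrow> 'i list \<Rightarrow> real" where
  "monotone_gain g xs = (SUP w\<in>{w. sorted (map w xs)}. \<Sum>i\<leftarrow>xs. 2 * g i * w i - (w i)\<^sup>2)"

lemma gain_term_le: "2 * a * b - b\<^sup>2 \<le> (a::real)\<^sup>2"
  using zero_le_power2[of "a - b"] by (simp add: power2_diff)

lemma bdd_above_gain: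
  "bdd_above ((\<lambda>w. \<Sum>i\<leftarrow>xs. 2 * g i * w i - (w i)\<^sup>2 :: real) ` A)"
  by (rule bdd_aboveI2[where M = "\<Sum>i\<leftarrow>xs. (g i)\<^sup>2"]) (intro sum_list_mono gain_term_le)

lemma sorted_map_nonempty: "{w :: 'i \<Rightarrow> real. sorted (map w xs)} \<noteq> {}"
proof -
  have "(\<lambda>_. 0) \<in> {w :: 'i \<Rightarrow> real. sorted (map w xs)}"
    by (simp add: map_replicate_const sorted_replicate)
  then show ?thesis by blast
qed

lemma gain_upper:
  assumes "sorted (map w xs)"
  shows "(\<Sum>i\<leftarrow>xs. 2 * g i * w i - (w i)\<^sup>2) \<le> monotone_gain g xs"
  unfolding monotone_gain_def using assms
  by (intro cSUP_upper bdd_above_gain) auto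

lemma gain_least:
  assumes "\<And>w. sorted (map w xs) \<Longrightarrow> (\<Sum>i\<leftarrow>xs. 2 * g i * w i - (w i)\<^sup>2) \<le> c"
  shows "monotone_gain g xs \<le> c"
  unfolding monotone_gain_def using assms sorted_map_nonempty[of xs]
  by (intro cSUP_least) auto

lemma gain_Nil: "monotone_gain g [] = 0"
  using gain_upper[of "\<lambda>_. 0" "[]" g] gain_least[of "[]" g 0] by simp

text \<open>Dropping the constraints across the cut enlarges the cone to the product of the two
  cones.\<close>

lemma gain_append: "monotone_gain g (ys @ zs) \<le> monotone_gain g ys + monotone_gain g zs"
  by (rule gain_least) (auto simp: sorted_append intro!: add_mono gain_upper)

lemma gain_cong:
  assumes "\<And>i. i \<in> set xs \<Longrightarrow> g i = h i"
  shows "monotone_gain g xs = monotone_gain h xs"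
  using assms unfolding monotone_gain_def
  by (intro arg_cong[where f = Sup] image_cong refl arg_cong[where f = sum_list] map_cong) auto

lemma gain_map:
  assumes "inj p"
  shows "monotone_gain g (map p xs) = monotone_gain (g \<circ> p) xs"
proof (rule antisym)
  show "monotone_gain g (map p xs) \<le> monotone_gain (g \<circ> p) xs"
    by (rule gain_least) (use gain_upper[of "_ \<circ> p" xs "g \<circ> p"] in \<open>auto simp: comp_def\<close>)
  show "monotone_gain (g \<circ> p) xs \<le> monotone_gain g (map p xs)"
  proof (rule gain_least)
    fix w :: "'a \<Rightarrow> real" assume "sorted (map w xs)"
    then show "(\<Sum>i\<leftarrow>xs. 2 * (g \<circ> p) i * w i - (w i)\<^sup>2) \<le> monotone_gain g (map p xs)"
      using gain_upper[of "w \<circ> inv p" "map p xs" g] assms by (simp add: comp_def)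
  qed
qed

section \<open>Block averages and the last block of the greatest convex minorant\<close>

definition avg :: "('i \<Rightarrow> real) \<Rightarrow> 'i set \<Rightarrow> real" where
  "avg g P = sum g P / real (card P)"

text \<open>The average over the union is a convex combination of the two averages with positive
  weights.\<close>

lemma avg_union_cases:
  assumes "finite P" "finite Q" "P \<inter> Q = {}" "P \<noteq> {}" "Q \<noteq> {}"
  obtains "avg g P < avg g (P \<union> Q)" "avg g (P \<union> Q) < avg g Q"
    | "avg g Q < avg g (P \<union> Q)" "avg g (P \<union> Q) < avg g P"
    | "avg g P = avg g (P \<union> Q)" "avg g Q = avg g (P \<union> Q)"
proof -
  define p q where "p = real (card P)" and "q = real (card Q)"
  have pq: "p > 0" "q > 0"
    using assms by (auto simp: p_def q_def card_gt_0_iff)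
  have *: "avg g (P \<union> Q) = (p * avg g P + q * avg g Q) / (p + q)"
    using pq assms by (simp add: avg_def sum.union_disjoint card_Un_disjoint p_def q_def)
  consider "avg g P < avg g Q" | "avg g P > avg g Q" | "avg g P = avg g Q" by linarith
  then show ?thesis
  proof cases
    case 1
    then have "avg g P < avg g (P \<union> Q)" "avg g (P \<union> Q) < avg g Q"
      using pq unfolding * by (simp_all add: field_simps)
    then show ?thesis by (rule that(1))
  next
    case 2
    then have "avg g Q < avg g (P \<union> Q)" "avg g (P \<union> Q) < avg g P"
      using pq unfolding * by (simp_all add: field_simps)
    then show ?thesis by (rule that(2))
  next
    case 3
    then have "avg g P = avg g (P \<union> Q)" "avg g Q = avg g (P \<union> Q)"
      using pq unfolding * by (simp_all add: field_simps)
    then show ?thesis by (rule that(3))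
  qed
qed

text \<open>Abel summation: each tail has a nonpositive sum of \<open>d\<close>, so passing from its
  head value to the smaller value in front of it can only raise the bound.\<close>

lemma sorted_sum_le_hd:
  fixes d w :: "'i \<Rightarrow> real"
  assumes "sorted (map w zs)" "zs \<noteq> []"
    and "\<And>vs. suffix vs zs \<Longrightarrow> (\<Sum>i\<leftarrow>vs. d i) \<le> 0"
  shows "(\<Sum>i\<leftarrow>zs. d i * w i) \<le> w (hd zs) * (\<Sum>i\<leftarrow>zs. d i)"
  using assms
proof (induction zs)
  case (Cons a zs)
  show ?case
  proof (cases "zs = []")
    case False
    have "(\<Sum>i\<leftarrow>zs. d i * w i) \<le> w (hd zs) * (\<Sum>i\<leftarrow>zs. d i)"
      using Cons False by (intro Cons.IH) (auto simp: suffix_Cons)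
    also have "\<dots> \<le> w a * (\<Sum>i\<leftarrow>zs. d i)"
      using Cons.prems False Cons.prems(3)[of zs]
      by (intro mult_right_mono_neg) (auto simp: suffix_Cons)
    finally show ?thesis by (simp add: algebra_simps)
  qed simp
qed simp

text \<open>The deviations of \<open>g\<close> from its overall average \<open>m\<close> have
  nonpositive sums over suffixes, so an increasing \<open>w\<close> correlates with \<open>g\<close>
  at most as it does with the constant \<open>m\<close>. Completing the square then gives
  \<open>m\<^sup>2\<close> per index.\<close>

lemma gain_block:
  assumes "distinct zs" "zs \<noteq> []"
    and le: "\<And>vs. suffix vs zs \<Longrightarrow> vs \<noteq> [] \<Longrightarrow> avg g (set vs) \<le> avg g (set zs)"
  shows "monotone_gain g zs \<le> (sum g (set zs))\<^sup>2 / real (card (set zs))"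
proof (rule gain_least)
  fix w :: "'a \<Rightarrow> real" assume w: "sorted (map w zs)"
  define m where "m = avg g (set zs)"
  define k where "k = real (card (set zs))"
  have k: "k > 0" "k = real (length zs)"
    using assms by (auto simp: k_def card_gt_0_iff distinct_card)
  have sum_d: "(\<Sum>i\<leftarrow>vs. g i - m) = (avg g (set vs) - m) * real (length vs)"
    if "suffix vs zs" "vs \<noteq> []" for vs
  proof -
    have "distinct vs" using that assms(1) by (auto simp: suffix_def)
    then show ?thesis using that
      by (simp add: sum_list_subtractf sum_list_triv avg_def distinct_card
          sum_list_distinct_conv_sum_set field_simps)
  qed
  have "(\<Sum>i\<leftarrow>zs. (g i - m) * w i) \<le> w (hd zs) * (\<Sum>i\<leftarrow>zs. g i - m)"
  proof (rule sorted_sum_le_hd[OF w assms(2)])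
    fix vs assume vs: "suffix vs zs"
    show "(\<Sum>i\<leftarrow>vs. g i - m) \<le> 0"
    proof (cases "vs = []")
      case False
      then show ?thesis using sum_d[OF vs False] le[OF vs False]
        by (simp add: m_def mult_nonpos_nonneg)
    qed simp
  qed
  also have "\<dots> = 0"
    using sum_d[of zs] assms(2) by (simp add: m_def)
  finally have cross: "(\<Sum>i\<leftarrow>zs. g i * w i) \<le> (\<Sum>i\<leftarrow>zs. m * w i)"
    by (simp add: left_diff_distrib sum_list_subtractf)
  have "(\<Sum>i\<leftarrow>zs. 2 * g i * w i - (w i)\<^sup>2) = 2 * (\<Sum>i\<leftarrow>zs. g i * w i) - (\<Sum>i\<leftarrow>zs. (w i)\<^sup>2)"
    by (simp add: sum_list_subtractf sum_list_const_mult mult.assoc)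
  also have "\<dots> \<le> 2 * (\<Sum>i\<leftarrow>zs. m * w i) - (\<Sum>i\<leftarrow>zs. (w i)\<^sup>2)"
    using cross by simp
  also have "\<dots> = (\<Sum>i\<leftarrow>zs. 2 * m * w i - (w i)\<^sup>2)"
    by (simp add: sum_list_subtractf sum_list_const_mult mult.assoc)
  also have "\<dots> \<le> (\<Sum>i\<leftarrow>zs. m\<^sup>2)"
    by (intro sum_list_mono gain_term_le)
  also have "\<dots> = (sum g (set zs))\<^sup>2 / real (card (set zs))"
    using k by (simp add: sum_list_triv m_def avg_def k_def[symmetric] power2_eq_square field_simps)
  finally show "(\<Sum>i\<leftarrow>zs. 2 * g i * w i - (w i)\<^sup>2) \<le> (sum g (set zs))\<^sup>2 / real (card (set zs))" .
qed

text \<open>General position: it excludes ties, so that the block decomposition is strict. Gaussian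
  noise satisfies it almost surely.\<close>

definition distinct_averages :: "('i \<Rightarrow> real) \<Rightarrow> 'i set \<Rightarrow> bool" where
  "distinct_averages g S \<longleftrightarrow> (\<forall>P Q. P \<subseteq> S \<and> Q \<subseteq> S \<and> P \<noteq> {} \<and> Q \<noteq> {} \<and> P \<inter> Q = {} \<longrightarrow> avg g P \<noteq> avg g Q)"

lemma distinct_averages_subset: "distinct_averages g S \<Longrightarrow> T \<subseteq> S \<Longrightarrow> distinct_averages g T"
  unfolding distinct_averages_def by (meson subset_trans)

text \<open>Proper suffixes average less than the whole, so proper prefixes average more and the
  partial sums stay strictly above their chord: the greatest convex minorant is a single
  segment.\<close>

definition irreducible_orderings :: "('i \<Rightarrow> real) \<Rightarrow> 'i set \<Rightarrow> 'i list set" where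
  "irreducible_orderings g P = {zs \<in> permutations_of_set P.
     \<forall>vs. strict_suffix vs zs \<and> vs \<noteq> [] \<longrightarrow> avg g (set vs) < avg g P}"

text \<open>In the recursion \<open>z\<close> is the average of the block just split off on the
  right, so that block averages increase along the list.\<close>

definition orderings_below :: "('i \<Rightarrow> real) \<Rightarrow> real \<Rightarrow> 'i set \<Rightarrow> 'i list set" where
  "orderings_below g z S = {xs \<in> permutations_of_set S.
     \<forall>vs. suffix vs xs \<and> vs \<noteq> [] \<longrightarrow> avg g (set vs) < z}"

lemma finite_irreducible_orderings: "finite (irreducible_orderings g P)"
  unfolding irreducible_orderings_def by simp

lemma finite_orderings_below: "finite (orderings_below g z S)"
  unfolding orderings_below_def by simp

text \<open>The last segment of the greatest convex minorant is the suffix of largest average.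
  Maximality, made strict by distinct averages, yields both irreducibility and the bound on what
  precedes it.\<close>

lemma last_block_exists:
  assumes "distinct xs" "xs \<noteq> []" and gen: "distinct_averages g (set xs)"
  obtains ys zs where "xs = ys @ zs" "zs \<noteq> []"
    "zs \<in> irreducible_orderings g (set zs)"
    "ys \<in> orderings_below g (avg g (set zs)) (set ys)"
    "monotone_gain g xs \<le> monotone_gain g ys + (sum g (set zs))\<^sup>2 / real (card (set zs))"
proof -
  let ?A = "{vs. suffix vs xs \<and> vs \<noteq> []}"
  have "finite {vs. suffix vs xs}"
    using set_suffixes_eq[of xs] by (metis List.finite_set)
  then have fin: "finite ?A" by simp
  have ne: "xs \<in> ?A" using assms by simp
  obtain zs where zs: "zs \<in> ?A" and "Max ((\<lambda>vs. avg g (set vs)) ` ?A) = avg g (set zs)"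
    using Max_in[of "(\<lambda>vs. avg g (set vs)) ` ?A"] fin ne by (metis (no_types, lifting) empty_iff finite_imageI image_iff)
  then have max: "avg g (set vs) \<le> avg g (set zs)" if "suffix vs xs" "vs \<noteq> []" for vs
    using fin that by (metis (mono_tags, lifting) Max_ge finite_imageI imageI mem_Collect_eq)
  obtain ys where xs: "xs = ys @ zs" using zs by (auto simp: suffix_def)
  have d: "distinct ys" "distinct zs" "set ys \<inter> set zs = {}"
    using assms(1) xs by auto
  have "zs \<in> irreducible_orderings g (set zs)"
  proof -
    \<comment> \<open>\<open>vs\<close> is also a suffix of \<open>xs\<close>, so its average cannot
      exceed that of \<open>zs\<close>; equality would force the complementary part
      \<open>us\<close> to have the same average.\<close>
    have "avg g (set vs) < avg g (set zs)" if vs: "strict_suffix vs zs" "vs \<noteq> []" for vs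
    proof -
      obtain us where us: "zs = us @ vs" using vs by (auto simp: strict_suffix_def suffix_def)
      with vs have une: "us \<noteq> []" by auto
      have le: "avg g (set vs) \<le> avg g (set zs)"
        using vs us xs by (intro max) (auto simp: suffix_def)
      have *: "avg g (set us) \<noteq> avg g (set vs)"
        using gen d us une vs xs unfolding distinct_averages_def by (auto 0 4)
      show ?thesis
        using avg_union_cases[of "set us" "set vs" g] d us une vs le *
        by (smt (verit) List.finite_set distinct_append set_append set_empty)
    qed
    with d show ?thesis by (auto simp: irreducible_orderings_def permutations_of_set_def)
  qed
  moreover have "ys \<in> orderings_below g (avg g (set zs)) (set ys)"
  proof -
    \<comment> \<open>The competitor is the suffix \<open>us @ zs\<close> of \<open>xs\<close>: its
      average is at most that of \<open>zs\<close>, which bounds the average of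
      \<open>us\<close>.\<close>
    have "avg g (set us) < avg g (set zs)" if us: "suffix us ys" "us \<noteq> []" for us
    proof -
      obtain ts where ts: "ys = ts @ us" using us by (auto simp: suffix_def)
      have "avg g (set (us @ zs)) \<le> avg g (set zs)"
        using us ts xs by (intro max) (auto simp: suffix_def)
      moreover have "avg g (set us) \<noteq> avg g (set zs)"
        using gen d ts us xs zs unfolding distinct_averages_def by (auto 0 4)
      moreover have "set us \<inter> set zs = {}" using d ts by auto
      ultimately show ?thesis
        using avg_union_cases[of "set us" "set zs" g] us zs
        by (smt (verit) List.finite_set set_append set_empty mem_Collect_eq)
    qed
    with d show ?thesis by (auto simp: orderings_below_def permutations_of_set_def)
  qed
  moreover have "monotone_gain g zs \<le> (sum g (set zs))\<^sup>2 / real (card (set zs))"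
    using d zs xs by (intro gain_block max) (auto simp: suffix_def)
  then have "monotone_gain g xs \<le> monotone_gain g ys + (sum g (set zs))\<^sup>2 / real (card (set zs))"
    using gain_append[of g ys zs] xs by simp
  ultimately show ?thesis using that xs zs by blast
qed

text \<open>Cycle lemma: at most one rotation of an ordering is irreducible.\<close>

lemma card_irreducible_orderings_le:
  assumes "finite P" "P \<noteq> {}"
  shows "card (irreducible_orderings g P) \<le> fact (card P - 1)"
proof -
  let ?I = "irreducible_orderings g P" and ?k = "card P"
  have k: "?k > 0" using assms by (simp add: card_gt_0_iff)
  have perm: "zs \<in> permutations_of_set P" if "zs \<in> ?I" for zs
    using that by (simp add: irreducible_orderings_def)
  have len: "length zs = ?k" if "zs \<in> ?I" for zs
    using perm[OF that] by (rule length_finite_permutations_of_set)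
  \<comment> \<open>A nontrivial rotation exchanges a prefix \<open>us\<close> and a suffix
    \<open>vs\<close>. If both orderings were irreducible, these complementary parts of
    \<open>P\<close> would both average below \<open>P\<close>.\<close>
  have rot0: "d = 0" if zs: "zs \<in> ?I" and rz: "rotate d zs \<in> ?I" and d: "d < ?k" for zs d
  proof (rule ccontr)
    assume "d \<noteq> 0"
    define us vs where "us = take d zs" and "vs = drop d zs"
    have zsuv: "zs = us @ vs" and ruv: "rotate d zs = vs @ us"
      using d len[OF zs] by (simp_all add: us_def vs_def rotate_drop_take)
    have ne: "us \<noteq> []" "vs \<noteq> []" using d \<open>d \<noteq> 0\<close> len[OF zs] by (auto simp: us_def vs_def)
    have "strict_suffix vs zs" "strict_suffix us (rotate d zs)"
      using ne by (auto simp: zsuv ruv[unfolded zsuv] strict_suffix_def suffix_def)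
    then have "avg g (set vs) < avg g P" "avg g (set us) < avg g P"
      using zs rz ne by (auto simp: irreducible_orderings_def)
    moreover have "P = set us \<union> set vs" "set us \<inter> set vs = {}"
      using perm[OF zs] zsuv by (auto simp: permutations_of_set_def)
    ultimately show False
      using avg_union_cases[of "set us" "set vs" g] ne by (metis List.finite_set order_less_asym order_less_irrefl set_empty)
  qed
  \<comment> \<open>Pairs of an irreducible ordering and a rotation amount thus inject into the
    orderings of \<open>P\<close>, so \<open>card ?I * ?k \<le> fact ?k\<close>.\<close>
  have inj: "inj_on (\<lambda>(zs, r). rotate r zs) (?I \<times> {..<?k})"
  proof -
    have *: "zs = zs' \<and> r = r'"
      if h: "zs \<in> ?I" "zs' \<in> ?I" "r < ?k" "r' < ?k" "r \<le> r'" "rotate r zs = rotate r' zs'" for zs zs' r r'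
    proof -
      have "rotate r zs = rotate r (rotate (r' - r) zs')"
        using h by (simp add: rotate_rotate)
      then have eq: "zs = rotate (r' - r) zs'" 
        using inj_rotate1[THEN inj_fn, of r] unfolding rotate_def by (rule injD[rotated])
      then have "r' - r = 0" using h by (intro rot0[of zs']) auto
      with eq h show ?thesis by simp
    qed
    show ?thesis
    proof (rule inj_onI, clarify)
      fix zs r zs' r' assume h: "zs \<in> ?I" "r < ?k" "zs' \<in> ?I" "r' < ?k" "rotate r zs = rotate r' zs'"
      show "zs = zs' \<and> r = r'"
        using *[of zs zs' r r'] *[of zs' zs r' r] h by (cases "r \<le> r'") auto
    qed
  qed
  have "(\<lambda>(zs, r). rotate r zs) ` (?I \<times> {..<?k}) \<subseteq> permutations_of_set P"
    using perm by (auto simp: permutations_of_set_def)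
  with inj have "card (?I \<times> {..<?k}) \<le> card (permutations_of_set P)"
    by (intro card_inj_on_le) auto
  then have "card ?I * ?k \<le> fact (?k - 1) * ?k"
    using assms k by (simp add: card_cartesian_product fact_reduce[of ?k] mult.commute)
  with k show ?thesis by simp
qed

section \<open>Sums over orderings and set partitions\<close>

text \<open>The factorial bounds the number of irreducible orderings of \<open>P\<close>; the
  exponential carries the bound on the gain of the block.\<close>

definition block_weight :: "real \<Rightarrow> ('i \<Rightarrow> real) \<Rightarrow> 'i set \<Rightarrow> real" where
  "block_weight s g P = fact (card P - 1) * exp (s * ((sum g P)\<^sup>2 / real (card P)))"

lemma block_weight_nonneg: "block_weight s g P \<ge> 0"
  by (simp add: block_weight_def)

text \<open>Splitting off the last block covers every ordering by some \<open>ys @ zs\<close> with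
  \<open>zs\<close> irreducible; the cycle lemma bounds the number of choices of
  \<open>zs\<close>.\<close>

lemma sum_orderings_below_le:
  assumes "finite S" "S \<noteq> {}" and gen: "distinct_averages g S" and "s \<ge> 0"
  shows "(\<Sum>xs\<in>orderings_below g z S. exp (s * monotone_gain g xs))
    \<le> (\<Sum>P\<in>{P. P \<subseteq> S \<and> P \<noteq> {} \<and> avg g P < z}. block_weight s g P *
         (\<Sum>ys\<in>orderings_below g (avg g P) (S - P). exp (s * monotone_gain g ys)))"
proof -
  let ?Ps = "{P. P \<subseteq> S \<and> P \<noteq> {} \<and> avg g P < z}"
  let ?f = "\<lambda>P. exp (s * ((sum g P)\<^sup>2 / real (card P)))"
  let ?e = "\<lambda>ys. exp (s * monotone_gain g ys)"
  let ?T = "SIGMA P:?Ps. irreducible_orderings g P \<times> orderings_below g (avg g P) (S - P)"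
  have finPs: "finite ?Ps" using assms(1) by simp
  have "(\<Sum>xs\<in>orderings_below g z S. ?e xs) \<le> (\<Sum>(P, zs, ys)\<in>?T. ?f P * ?e ys)"
  proof (rule sum_le_included[where i = "\<lambda>(P, zs, ys). ys @ zs"], goal_cases)
    case 2
    show ?case using finPs finite_irreducible_orderings finite_orderings_below by blast
  next
    case 4
    show ?case
    proof
      fix xs assume xs: "xs \<in> orderings_below g z S"
      then have p: "set xs = S" "distinct xs" by (auto simp: orderings_below_def permutations_of_set_def)
      with assms have "xs \<noteq> []" "distinct_averages g (set xs)" by auto
      from last_block_exists[OF p(2) this] obtain ys zs where b: "xs = ys @ zs" "zs \<noteq> []"
        "zs \<in> irreducible_orderings g (set zs)"
        "ys \<in> orderings_below g (avg g (set zs)) (set ys)"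
        "monotone_gain g xs \<le> monotone_gain g ys + (sum g (set zs))\<^sup>2 / real (card (set zs))" .
      have "set ys = S - set zs" using p b(1) by auto
      moreover have "avg g (set zs) < z"
        using xs b(1,2) by (auto simp: orderings_below_def suffix_def)
      ultimately have "(set zs, zs, ys) \<in> ?T" using b p by auto
      moreover have "?e xs \<le> ?f (set zs) * ?e ys"
        using mult_left_mono[OF b(5) assms(4)] by (simp add: exp_add[symmetric] algebra_simps)
      ultimately show "\<exists>y\<in>?T. (case y of (P, zs, ys) \<Rightarrow> ys @ zs) = xs \<and> ?e xs \<le> (case y of (P, zs, ys) \<Rightarrow> ?f P * ?e ys)"
        using b(1) by (intro bexI[of _ "(set zs, zs, ys)"]) auto
    qed
  qed (auto simp: finite_orderings_below)
  also have "\<dots> = (\<Sum>P\<in>?Ps. \<Sum>zs\<in>irreducible_orderings g P. \<Sum>ys\<in>orderings_below g (avg g P) (S - P). ?f P * ?e ys)"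
    using finPs finite_irreducible_orderings[of g] finite_orderings_below[of g]
    by (subst sum.Sigma[symmetric]) (simp_all only: sum.cartesian_product finite_cartesian_product split_conv ball_triv simp_thms)
  also have "\<dots> = (\<Sum>P\<in>?Ps. real (card (irreducible_orderings g P)) * ?f P * (\<Sum>ys\<in>orderings_below g (avg g P) (S - P). ?e ys))"
    by (simp add: sum_distrib_left mult.assoc)
  also have "\<dots> \<le> (\<Sum>P\<in>?Ps. block_weight s g P * (\<Sum>ys\<in>orderings_below g (avg g P) (S - P). ?e ys))"
  proof (rule sum_mono)
    fix P assume "P \<in> ?Ps"
    then have "card (irreducible_orderings g P) \<le> fact (card P - 1)"
      using assms(1) by (intro card_irreducible_orderings_le) (auto intro: finite_subset)
    then have "real (card (irreducible_orderings g P)) \<le> fact (card P - 1)"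
      by (metis of_nat_fact of_nat_le_iff)
    then show "real (card (irreducible_orderings g P)) * ?f P * (\<Sum>ys\<in>orderings_below g (avg g P) (S - P). ?e ys)
      \<le> block_weight s g P * (\<Sum>ys\<in>orderings_below g (avg g P) (S - P). ?e ys)"
      unfolding block_weight_def by (intro mult_right_mono sum_nonneg) auto
  qed
  finally show ?thesis .
qed

text \<open>A block \<open>P\<close> with a partition of the rest into blocks of smaller
  \<open>m\<close> is a partition of \<open>S\<close> in which \<open>P\<close> is the unique
  maximum, so no partition is counted twice. Nonnegative weights allow the sum to be extended to all
  partitions.\<close>

lemma sum_partitions_largest_block_le:
  fixes m :: "'i set \<Rightarrow> real" and w :: "'i set \<Rightarrow> real"
  assumes "finite S" and w: "\<And>P. w P \<ge> 0"
  shows "(\<Sum>P\<in>{P. P \<subseteq> S \<and> P \<noteq> {} \<and> m P < z}. w P *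
           (\<Sum>X\<in>{X. partition_on (S - P) X \<and> (\<forall>Q\<in>X. m Q < m P)}. \<Prod>Q\<in>X. w Q))
    \<le> (\<Sum>X\<in>{X. partition_on S X \<and> (\<forall>Q\<in>X. m Q < z)}. \<Prod>Q\<in>X. w Q)"
proof -
  let ?Ps = "{P. P \<subseteq> S \<and> P \<noteq> {} \<and> m P < z}"
  let ?R = "\<lambda>P. {X. partition_on (S - P) X \<and> (\<forall>Q\<in>X. m Q < m P)}"
  have fin: "finite ?Ps" "\<And>P. finite (?R P)"
    using assms(1) finitely_many_partition_on[of "S - _"] by auto
  have "(\<Sum>P\<in>?Ps. w P * (\<Sum>X\<in>?R P. \<Prod>Q\<in>X. w Q)) = (\<Sum>(P, X)\<in>Sigma ?Ps ?R. \<Prod>Q\<in>insert P X. w Q)"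
  proof -
    have "w P * (\<Prod>Q\<in>X. w Q) = (\<Prod>Q\<in>insert P X. w Q)" if "X \<in> ?R P" for P X
    proof -
      have "P \<notin> X" using that by auto
      moreover have "finite X" using that assms(1) by (auto intro: finite_elements[of "S - P"])
      ultimately show ?thesis by simp
    qed
    then show ?thesis using fin by (simp add: sum_distrib_left sum.Sigma)
  qed
  also have "\<dots> = (\<Sum>X\<in>(\<lambda>(P, X). insert P X) ` Sigma ?Ps ?R. \<Prod>Q\<in>X. w Q)"
  proof (subst sum.reindex)
    show "inj_on (\<lambda>(P, X). insert P X) (Sigma ?Ps ?R)"
    proof (rule inj_onI, clarify)
      fix P X P' X'
      assume *: "partition_on (S - P) X" "\<forall>Q\<in>X. m Q < m P" "partition_on (S - P') X'"
        "\<forall>Q\<in>X'. m Q < m P'" "insert P X = insert P' X'"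
      then have "P = P'" by (metis insertCI insertE order_less_asym)
      moreover have "P \<notin> X" "P' \<notin> X'" using * by auto
      ultimately show "P = P' \<and> X = X'" using *(5) by (metis insert_ident)
    qed
  qed (auto simp: case_prod_beta intro!: sum.cong)
  also have "\<dots> \<le> (\<Sum>X\<in>{X. partition_on S X \<and> (\<forall>Q\<in>X. m Q < z)}. \<Prod>Q\<in>X. w Q)"
  proof (rule sum_mono2)
    show "finite {X. partition_on S X \<and> (\<forall>Q\<in>X. m Q < z)}"
      using assms(1) finitely_many_partition_on[of S] by auto
    show "(\<lambda>(P, X). insert P X) ` Sigma ?Ps ?R \<subseteq> {X. partition_on S X \<and> (\<forall>Q\<in>X. m Q < z)}"
    proof clarify
      fix P X assume *: "P \<subseteq> S" "P \<noteq> {}" "m P < z" "partition_on (S - P) X" "\<forall>Q\<in>X. m Q < m P"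
      have "disjnt P (\<Union>X)" using partition_onD1[OF *(4)] by (auto simp: disjnt_iff)
      then show "partition_on S (insert P X) \<and> (\<forall>Q\<in>insert P X. m Q < z)"
        using * by (auto simp: partition_on_insert)
    qed
  qed (auto intro!: prod_nonneg w)
  finally show ?thesis .
qed

text \<open>The last block is split off, the induction hypothesis applies to the remaining indices
  with its average as threshold, and the choices are reassembled into partitions.\<close>

lemma sum_orderings_below_le_partitions:
  assumes "finite S" "distinct_averages g S" "s \<ge> 0"
  shows "(\<Sum>xs\<in>orderings_below g z S. exp (s * monotone_gain g xs))
    \<le> (\<Sum>X\<in>{X. partition_on S X \<and> (\<forall>P\<in>X. avg g P < z)}. \<Prod>P\<in>X. block_weight s g P)"
  using assms(1,2)
proof (induction "card S" arbitrary: S z rule: less_induct)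
  case less
  show ?case
  proof (cases "S = {}")
    case True
    have "{X. partition_on {} X \<and> (\<forall>P\<in>X. avg g P < z)} = {{}}"
      by (auto simp: partition_on_empty)
    moreover have "orderings_below g z {} = {[]}"
      by (auto simp: orderings_below_def)
    ultimately show ?thesis using True by (simp add: gain_Nil)
  next
    case False
    have "(\<Sum>xs\<in>orderings_below g z S. exp (s * monotone_gain g xs))
      \<le> (\<Sum>P\<in>{P. P \<subseteq> S \<and> P \<noteq> {} \<and> avg g P < z}. block_weight s g P *
           (\<Sum>ys\<in>orderings_below g (avg g P) (S - P). exp (s * monotone_gain g ys)))"
      using less.prems False assms(3) by (intro sum_orderings_below_le)
    also have "\<dots> \<le> (\<Sum>P\<in>{P. P \<subseteq> S \<and> P \<noteq> {} \<and> avg g P < z}. block_weight s g P *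
        (\<Sum>X\<in>{X. partition_on (S - P) X \<and> (\<forall>Q\<in>X. avg g Q < avg g P)}. \<Prod>Q\<in>X. block_weight s g Q))"
    proof (intro sum_mono mult_left_mono block_weight_nonneg less.hyps)
      fix P assume P: "P \<in> {P. P \<subseteq> S \<and> P \<noteq> {} \<and> avg g P < z}"
      then show "card (S - P) < card S"
        using less.prems by (intro psubset_card_mono) auto
      show "finite (S - P)" "distinct_averages g (S - P)"
        using less.prems by (auto intro: distinct_averages_subset)
    qed
    also have "\<dots> \<le> (\<Sum>X\<in>{X. partition_on S X \<and> (\<forall>P\<in>X. avg g P < z)}. \<Prod>P\<in>X. block_weight s g P)"
      using less.prems by (intro sum_partitions_largest_block_le block_weight_nonneg)
    finally show ?thesis .
  qed
qed

text \<open>After summation over all orderings, the random blocks of the minorant have become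
  deterministic set partitions.\<close>

lemma sum_permutations_exp_gain_le:
  assumes "finite S" "distinct_averages g S" "s \<ge> 0"
  shows "(\<Sum>xs\<in>permutations_of_set S. exp (s * monotone_gain g xs))
    \<le> (\<Sum>X\<in>{X. partition_on S X}. \<Prod>P\<in>X. block_weight s g P)"
proof -
  \<comment> \<open>Above the average of every subset of \<open>S\<close>, so that the threshold
    restricts neither side.\<close>
  define z where "z = Max (avg g ` Pow S) + 1"
  have z: "avg g P < z" if "P \<subseteq> S" for P
  proof -
    have "avg g P \<le> Max (avg g ` Pow S)" using that assms(1) by (intro Max_ge) auto
    then show ?thesis by (simp add: z_def)
  qed
  have "orderings_below g z S = permutations_of_set S"
    using z by (auto simp: orderings_below_def permutations_of_set_def dest!: set_mono_suffix)
  moreover have "{X. partition_on S X \<and> (\<forall>P\<in>X. avg g P < z)} = {X. partition_on S X}"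
    using z by (auto simp: partition_on_def)
  ultimately show ?thesis
    using sum_orderings_below_le_partitions[OF assms, of z] by simp
qed

section \<open>Counting weighted set partitions\<close>

lemma sum_Pow_card:
  fixes h :: "nat \<Rightarrow> real"
  assumes "finite A"
  shows "(\<Sum>Q\<in>Pow A. h (card Q)) = (\<Sum>j\<le>card A. real (card A choose j) * h j)"
proof -
  have "(\<Sum>Q\<in>Pow A. h (card Q)) = (\<Sum>j\<in>{..card A}. \<Sum>Q\<in>{Q \<in> Pow A. card Q = j}. h (card Q))"
    using assms by (intro sum.group[symmetric]) (auto intro: card_mono)
  also have "\<dots> = (\<Sum>j\<le>card A. real (card A choose j) * h j)"
    using assms n_subsets[OF assms] by (intro sum.cong) auto
  finally show ?thesis .
qed

text \<open>\<open>fact (card P - 1)\<close> counts the cycles on \<open>P\<close>, so the sum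
  weighs each permutation of \<open>S\<close> by 2 per cycle; its value is the rising factorial
  \<open>2 * 3 * ... * (card S + 1)\<close>. The proof conditions on the block of a fixed element
  \<open>a\<close>.\<close>

lemma sum_partitions_fact_le:
  assumes "finite S"
  shows "(\<Sum>X\<in>{X. partition_on S X}. \<Prod>P\<in>X. 2 * fact (card P - 1)) \<le> (fact (card S + 1) :: real)"
  using assms
proof (induction "card S" arbitrary: S rule: less_induct)
  case less
  let ?w = "\<lambda>P. 2 * fact (card P - 1) :: real"
  show ?case
  proof (cases "S = {}")
    case True
    moreover have "Collect (partition_on ({} :: 'a set)) = {{}}" by (auto simp: partition_on_empty)
    ultimately show ?thesis by simp
  next
    case False
    then obtain a where a: "a \<in> S" by blast
    define A where "A = S - {a}"
    have A: "finite A" "a \<notin> A" "S = insert a A" "card S = Suc (card A)"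
      using less.prems a card_Suc_Diff1[of S a] by (auto simp: A_def)
    let ?T = "SIGMA Q:Pow A. {X. partition_on (A - Q) X}"
    have "(\<Sum>X\<in>{X. partition_on S X}. \<Prod>P\<in>X. ?w P) \<le> (\<Sum>(Q, X)\<in>?T. ?w (insert a Q) * (\<Prod>P\<in>X. ?w P))"
    proof (rule sum_le_included[where i = "\<lambda>(Q, X). insert (insert a Q) X"], goal_cases)
      case 1
      show ?case using less.prems by (rule finitely_many_partition_on)
    next
      case 2
      show ?case using A(1) finitely_many_partition_on[of "A - _"] by (intro finite_SigmaI) auto
    next
      case 3
      show ?case by (auto intro!: mult_nonneg_nonneg prod_nonneg)
    next
      case 4
      show ?case
      proof clarify
        fix X assume X: "partition_on S X"
        then obtain P where P: "P \<in> X" "a \<in> P" using a by (auto dest: partition_onD1)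
        define Q Y where "Q = P - {a}" and "Y = X - {P}"
        have e: "P = insert a Q" "X = insert P Y" "P \<notin> Y" using P by (auto simp: Q_def Y_def)
        have dj: "disjnt P (\<Union>Y)"
          using pairwiseD[OF partition_onD2[OF X] P(1)] unfolding Y_def disjnt_iff by blast
        then have Y: "partition_on (S - P) Y" and "P \<subseteq> S" using X e(2) by (simp_all add: partition_on_insert)
        have "S - P = A - Q" "Q \<subseteq> A" using P(2) \<open>P \<subseteq> S\<close> unfolding Q_def A_def by blast+
        with Y have "(Q, Y) \<in> ?T" by simp
        moreover have "finite Y" using finite_elements[OF less.prems X] by (simp add: Y_def)
        then have "(\<Prod>P\<in>X. ?w P) = ?w (insert a Q) * (\<Prod>P\<in>Y. ?w P)"
          using prod.insert[OF _ e(3), of ?w] e(1,2) by simp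
        ultimately show "\<exists>y\<in>?T. (case y of (Q, X) \<Rightarrow> insert (insert a Q) X) = X \<and>
            (\<Prod>P\<in>X. ?w P) \<le> (case y of (Q, X) \<Rightarrow> ?w (insert a Q) * (\<Prod>P\<in>X. ?w P))"
          using e by (intro bexI[of _ "(Q, Y)"]) simp_all
      qed
    qed
    also have "\<dots> = (\<Sum>Q\<in>Pow A. ?w (insert a Q) * (\<Sum>X\<in>{X. partition_on (A - Q) X}. \<Prod>P\<in>X. ?w P))"
      using A(1) finitely_many_partition_on[of "A - _"]
      by (subst sum.Sigma[symmetric]) (auto simp: sum_distrib_left)
    also have "\<dots> \<le> (\<Sum>Q\<in>Pow A. 2 * fact (card Q) * fact (card A - card Q + 1))"
    proof (rule sum_mono)
      fix Q assume Q: "Q \<in> Pow A"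
      then have fQ: "finite Q" "a \<notin> Q" using A by (auto intro: finite_subset)
      have "(\<Sum>X\<in>{X. partition_on (A - Q) X}. \<Prod>P\<in>X. ?w P) \<le> fact (card (A - Q) + 1)"
        using A by (intro less.hyps) (auto intro!: le_imp_less_Suc card_mono)
      also have "card (A - Q) = card A - card Q" using Q fQ by (auto intro: card_Diff_subset)
      finally show "?w (insert a Q) * (\<Sum>X\<in>{X. partition_on (A - Q) X}. \<Prod>P\<in>X. ?w P)
          \<le> 2 * fact (card Q) * fact (card A - card Q + 1)"
        using fQ by (simp add: mult_left_mono)
    qed
    also have "\<dots> = (\<Sum>j\<le>card A. real (card A choose j) * (2 * fact j * fact (card A - j + 1)))"
      by (rule sum_Pow_card[OF A(1), where h = "\<lambda>j. 2 * fact j * fact (card A - j + 1)"])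
    also have "\<dots> = (\<Sum>j\<le>card A. 2 * fact (card A) * (real (card A - j) + 1))"
    proof (rule sum.cong[OF refl])
      fix j assume "j \<in> {..card A}"
      then have "fact j * fact (card A - j) * real (card A choose j) = fact (card A)"
        by (metis atMost_iff binomial_fact_lemma of_nat_fact of_nat_mult)
      moreover have "fact (card A - j + 1) = (real (card A - j) + 1) * fact (card A - j)"
        by simp
      ultimately show "real (card A choose j) * (2 * fact j * fact (card A - j + 1)) = 2 * fact (card A) * (real (card A - j) + 1)"
        by (metis (no_types, opaque_lifting) mult.assoc mult.commute)
    qed
    also have "\<dots> = 2 * fact (card A) * (\<Sum>j\<le>card A. real j + 1)"
      using sum.atLeastAtMost_rev[of "\<lambda>j. real j + 1" 0 "card A"]
      by (simp only: sum_distrib_left[symmetric] atMost_atLeast0) simp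
    also have "(\<Sum>j\<le>card A. real j + 1) = (real (card A) + 1) * (real (card A) + 2) / 2"
    proof -
      have "(\<Sum>j\<le>N. real j + 1) = (real N + 1) * (real N + 2) / 2" for N
        by (induction N) (simp_all add: field_simps)
      then show ?thesis .
    qed
    also have "2 * fact (card A) * \<dots> = fact (card S + 1)"
      using A(4) by (simp add: algebra_simps)
    finally show ?thesis .
  qed
qed

section \<open>Exponential moments under Gaussian noise\<close>

text \<open>The supremum is over an uncountable family, but it is lower semicontinuous: a strict
  superlevel set is a union of open sets, one for each admissible \<open>w\<close>.\<close>

lemma borel_measurable_gain [measurable]:
  "(\<lambda>g :: nat \<Rightarrow> real. monotone_gain g xs) \<in> borel_measurable borel"
proof (subst borel_measurable_iff_greater, intro allI)
  fix a :: real
  have cont: "continuous_on UNIV (\<lambda>g :: nat \<Rightarrow> real. \<Sum>i\<leftarrow>xs. 2 * g i * w i - (w i)\<^sup>2)" for w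
    by (induction xs) (auto intro!: continuous_intros)
  have "{g :: nat \<Rightarrow> real. a < monotone_gain g xs}
      = (\<Union>w\<in>{w. sorted (map w xs)}. {g. a < (\<Sum>i\<leftarrow>xs. 2 * g i * w i - (w i)\<^sup>2)})"
    unfolding monotone_gain_def
    by (subst less_cSUP_iff[OF sorted_map_nonempty bdd_above_gain]) auto
  also have "open \<dots>"
    by (intro open_UN ballI open_Collect_less cont continuous_on_const)
  finally show "{g \<in> space borel. a < monotone_gain (g :: nat \<Rightarrow> real) xs} \<in> sets borel"
    by simp
qed

text \<open>Coordinates outside \<open>K\<close> are constantly \<open>undefined\<close> on the
  product space, hence measurable. This lets functionals that are Borel on the whole function space
  act on restricted noise.\<close>

lemma measurable_PiM_into_borel:
  "(\<lambda>g. g) \<in> measurable (PiM K (\<lambda>_ :: nat. borel :: real measure)) (borel :: (nat \<Rightarrow> real) measure)"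
proof (rule measurable_coordinatewise_then_product)
  fix i :: nat
  show "(\<lambda>g. g i) \<in> borel_measurable (PiM K (\<lambda>_. borel :: real measure))"
  proof (cases "i \<in> K")
    case True
    then show ?thesis by simp
  next
    case False
    then have "g i = undefined" if "g \<in> space (PiM K (\<lambda>_. borel :: real measure))" for g
      using that by (auto simp: space_PiM PiE_def extensional_def)
    then show ?thesis by (subst measurable_cong[where g = "\<lambda>_. undefined"]) auto
  qed
qed

section \<open>Independence and exchangeability\<close>

context prob_space
begin

text \<open>Each factor sees only its own group of coordinates, so it can be evaluated at the
  restricted noise, and restrictions to disjoint groups are independent.\<close>

lemma nn_integral_prod_groups:
  fixes \<xi> :: "nat \<Rightarrow> 'a \<Rightarrow> real" and H :: "'j \<Rightarrow> (nat \<Rightarrow> real) \<Rightarrow> ennreal"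
  assumes "indep_vars (\<lambda>_. borel) \<xi> I" "finite J" "\<And>j. j \<in> J \<Longrightarrow> K j \<subseteq> I"
    and "disjoint_family_on K J"
    and meas: "\<And>j. j \<in> J \<Longrightarrow> H j \<in> borel_measurable borel"
    and local: "\<And>j g h. j \<in> J \<Longrightarrow> (\<And>i. i \<in> K j \<Longrightarrow> g i = h i) \<Longrightarrow> H j g = H j h"
  shows "(\<integral>\<^sup>+\<omega>. (\<Prod>j\<in>J. H j (\<lambda>i. \<xi> i \<omega>)) \<partial>M) = (\<Prod>j\<in>J. \<integral>\<^sup>+\<omega>. H j (\<lambda>i. \<xi> i \<omega>) \<partial>M)"
proof -
  have "indep_vars (\<lambda>j. PiM (K j) (\<lambda>_. borel)) (\<lambda>j \<omega>. restrict (\<lambda>i. \<xi> i \<omega>) (K j)) J"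
    using assms by (intro indep_vars_restrict) auto
  then have "indep_vars (\<lambda>_. borel) (\<lambda>j \<omega>. H j (restrict (\<lambda>i. \<xi> i \<omega>) (K j))) J"
    by (rule indep_vars_compose2) (use measurable_compose[OF measurable_PiM_into_borel meas] in simp)
  then have "(\<integral>\<^sup>+\<omega>. (\<Prod>j\<in>J. H j (restrict (\<lambda>i. \<xi> i \<omega>) (K j))) \<partial>M)
      = (\<Prod>j\<in>J. \<integral>\<^sup>+\<omega>. H j (restrict (\<lambda>i. \<xi> i \<omega>) (K j)) \<partial>M)"
    using assms(2) by (intro indep_vars_nn_integral) auto
  moreover have "H j (restrict (\<lambda>i. \<xi> i \<omega>) (K j)) = H j (\<lambda>i. \<xi> i \<omega>)" if "j \<in> J" for j \<omega>
    using that by (intro local) auto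
  ultimately show ?thesis by simp
qed

lemma indep_vars_borel_reindex:
  assumes "indep_vars (\<lambda>_. borel) X I" "inj_on p J" "p ` J \<subseteq> I"
  shows "indep_vars (\<lambda>_. borel) (\<lambda>j. X (p j)) J"
proof -
  have "indep_vars (\<lambda>j. PiM {p j} (\<lambda>_. borel)) (\<lambda>j \<omega>. restrict (\<lambda>i. X i \<omega>) {p j}) J"
    using assms by (intro indep_vars_restrict) (auto simp: disjoint_family_on_def inj_on_def)
  then have "indep_vars (\<lambda>_. borel) (\<lambda>j \<omega>. (restrict (\<lambda>i. X i \<omega>) {p j}) (p j)) J"
    by (rule indep_vars_compose2) simp
  then show ?thesis by simp
qed

text \<open>Independence makes the joint law the product of the marginals. Applied to permuted
  noise, this is exchangeability.\<close>

lemma nn_integral_indep_same_marginals: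
  fixes \<xi> \<eta> :: "nat \<Rightarrow> 'a \<Rightarrow> real" and H :: "(nat \<Rightarrow> real) \<Rightarrow> ennreal"
  assumes "indep_vars (\<lambda>_. borel) \<xi> S" "indep_vars (\<lambda>_. borel) \<eta> S"
    and marg: "\<And>i. i \<in> S \<Longrightarrow> distr M borel (\<xi> i) = distr M borel (\<eta> i)"
    and meas: "H \<in> borel_measurable borel"
    and local: "\<And>g h. (\<And>i. i \<in> S \<Longrightarrow> g i = h i) \<Longrightarrow> H g = H h"
  shows "(\<integral>\<^sup>+\<omega>. H (\<lambda>i. \<xi> i \<omega>) \<partial>M) = (\<integral>\<^sup>+\<omega>. H (\<lambda>i. \<eta> i \<omega>) \<partial>M)"
proof (cases "S = {}")
  case True
  then show ?thesis by (intro nn_integral_cong local) auto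
next
  case False
  have joint: "(\<integral>\<^sup>+\<omega>. H (\<lambda>i. \<zeta> i \<omega>) \<partial>M) = integral\<^sup>N (PiM S (\<lambda>i. distr M borel (\<zeta> i))) H"
    if ind: "indep_vars (\<lambda>_. borel) \<zeta> S" for \<zeta> :: "nat \<Rightarrow> 'a \<Rightarrow> real"
  proof -
    have rv: "\<And>i. i \<in> S \<Longrightarrow> random_variable borel (\<zeta> i)"
      using ind by (auto simp: indep_vars_def)
    have eq: "distr M (PiM S (\<lambda>_. borel)) (\<lambda>\<omega>. \<lambda>i\<in>S. \<zeta> i \<omega>) = PiM S (\<lambda>i. distr M borel (\<zeta> i))"
      using ind by (subst (asm) indep_vars_iff_distr_eq_PiM'[OF False rv]) auto
    have "(\<integral>\<^sup>+\<omega>. H (\<lambda>i. \<zeta> i \<omega>) \<partial>M) = (\<integral>\<^sup>+\<omega>. H (\<lambda>i\<in>S. \<zeta> i \<omega>) \<partial>M)"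
      by (intro nn_integral_cong local) auto
    also have "\<dots> = integral\<^sup>N (distr M (PiM S (\<lambda>_. borel)) (\<lambda>\<omega>. \<lambda>i\<in>S. \<zeta> i \<omega>)) H"
      using rv measurable_compose[OF measurable_PiM_into_borel meas]
      by (subst nn_integral_distr) (auto intro!: measurable_restrict)
    finally show ?thesis unfolding eq .
  qed
  have "PiM S (\<lambda>i. distr M borel (\<xi> i)) = PiM S (\<lambda>i. distr M borel (\<eta> i))"
    using marg by (intro PiM_cong) auto
  then show ?thesis using joint[OF assms(1)] joint[OF assms(2)] by simp
qed

end

lemma list_permutation_exists:
  assumes "distinct xs" "distinct ys" "set xs = set ys"
  obtains p where "p permutes set xs" "ys = map p xs"
proof -
  define p where "p i = (if i \<in> set xs then ys ! (THE k. k < length xs \<and> xs ! k = i) else i)" for i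
  have len: "length ys = length xs" using assms by (metis distinct_card)
  have pk: "p (xs ! k) = ys ! k" if "k < length xs" for k
  proof -
    have "(THE k'. k' < length xs \<and> xs ! k' = xs ! k) = k"
      using that assms(1) by (auto simp: nth_eq_iff_index_eq)
    then show ?thesis using that by (simp add: p_def)
  qed
  then have map: "ys = map p xs" using len by (auto intro: nth_equalityI)
  have "bij_betw p (set xs) (set xs)"
    using map assms by (metis bij_betw_def distinct_map list.set_map)
  then have "p permutes set xs" by (rule bij_imp_permutes) (simp add: p_def)
  with map show ?thesis using that by blast
qed

text \<open>The exponential cancels half of the Gaussian exponent, which leaves
  \<open>sqrt 2\<close> times the density with doubled variance.\<close>

lemma nn_integral_exp_normal_density:
  assumes "\<tau> > 0"
  shows "(\<integral>\<^sup>+x. ennreal (normal_density 0 \<tau> x) * ennreal (exp (x\<^sup>2 / (4 * \<tau>\<^sup>2))) \<partial>lborel) = ennreal (sqrt 2)"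
proof -
  have "normal_density 0 \<tau> x * exp (x\<^sup>2 / (4 * \<tau>\<^sup>2)) = sqrt 2 * normal_density 0 (sqrt 2 * \<tau>) x" for x
  proof -
    have "exp (- (x\<^sup>2 / (2 * \<tau>\<^sup>2))) * exp (x\<^sup>2 / (4 * \<tau>\<^sup>2)) = exp (- (x\<^sup>2 / (2 * (2 * \<tau>\<^sup>2))))"
      using assms by (simp add: exp_add[symmetric] field_simps)
    then show ?thesis
      using assms by (simp add: normal_density_def power_mult_distrib real_sqrt_mult field_simps)
  qed
  then have "(\<integral>\<^sup>+x. ennreal (normal_density 0 \<tau> x) * ennreal (exp (x\<^sup>2 / (4 * \<tau>\<^sup>2))) \<partial>lborel)
     = (\<integral>\<^sup>+x. ennreal (sqrt 2) * ennreal (normal_density 0 (sqrt 2 * \<tau>) x) \<partial>lborel)"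
    by (simp add: ennreal_mult[symmetric])
  also have "\<dots> = ennreal (sqrt 2) * (\<integral>\<^sup>+x. ennreal (normal_density 0 (sqrt 2 * \<tau>) x) \<partial>lborel)"
    by (rule nn_integral_cmult) simp
  also have "(\<integral>\<^sup>+x. ennreal (normal_density 0 (sqrt 2 * \<tau>) x) \<partial>lborel) = 1"
    using assms by (subst nn_integral_eq_integral) (auto simp: normal_density_nonneg)
  finally show ?thesis by simp
qed

section \<open>Moments of blocks and monotone cones\<close>

locale gaussian_noise = prob_space +
  fixes \<xi> :: "nat \<Rightarrow> 'a \<Rightarrow> real" and I :: "nat set" and \<sigma> :: real
  assumes finite_I: "finite I" and sigma_pos: "\<sigma> > 0"
    and indep: "indep_vars (\<lambda>_. borel) \<xi> I"
    and normal: "\<And>i. i \<in> I \<Longrightarrow> distributed M lborel (\<xi> i) (normal_density 0 \<sigma>)"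
begin

lemma measurable_xi: "i \<in> I \<Longrightarrow> \<xi> i \<in> borel_measurable M"
  using indep by (auto simp: indep_vars_def)

text \<open>The block sum is normal with variance \<open>card P * \<sigma>\<^sup>2\<close>, so the
  exponent is a quarter of a squared standard normal. Rounding \<open>sqrt 2\<close> up to 2 makes
  the later sum over partitions a plain factorial.\<close>

lemma nn_integral_exp_block:
  assumes "P \<subseteq> I" "P \<noteq> {}"
  shows "(\<integral>\<^sup>+\<omega>. exp ((1 / (4 * \<sigma>\<^sup>2)) * ((\<Sum>i\<in>P. \<xi> i \<omega>)\<^sup>2 / real (card P))) \<partial>M) \<le> 2"
proof -
  have fin: "finite P" using assms finite_I by (auto intro: finite_subset)
  define k where "k = real (card P)"
  have k: "k > 0" using fin assms by (simp add: k_def card_gt_0_iff)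
  define \<tau> where "\<tau> = sqrt (\<Sum>i\<in>P. \<sigma>\<^sup>2)"
  have \<tau>: "\<tau>\<^sup>2 = k * \<sigma>\<^sup>2" "\<tau> > 0" using k sigma_pos by (simp_all add: \<tau>_def k_def)
  have "distributed M lborel (\<lambda>\<omega>. \<Sum>i\<in>P. \<xi> i \<omega>) (normal_density (\<Sum>i\<in>P. 0) \<tau>)"
    unfolding \<tau>_def using assms fin sigma_pos normal
    by (intro sum_indep_normal indep_vars_subset[OF indep]) auto
  then have "distributed M lborel (\<lambda>\<omega>. \<Sum>i\<in>P. \<xi> i \<omega>) (normal_density 0 \<tau>)" by simp
  from distributed_nn_integral[OF this, of "\<lambda>x. ennreal (exp (x\<^sup>2 / (4 * \<tau>\<^sup>2)))"]
  have "(\<integral>\<^sup>+\<omega>. exp ((\<Sum>i\<in>P. \<xi> i \<omega>)\<^sup>2 / (4 * \<tau>\<^sup>2)) \<partial>M) = ennreal (sqrt 2)"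
    using nn_integral_exp_normal_density[OF \<tau>(2)] by simp
  moreover have "(1 / (4 * \<sigma>\<^sup>2)) * ((\<Sum>i\<in>P. \<xi> i \<omega>)\<^sup>2 / real (card P)) = (\<Sum>i\<in>P. \<xi> i \<omega>)\<^sup>2 / (4 * \<tau>\<^sup>2)" for \<omega>
    using \<tau>(1) by (simp add: k_def mult_ac)
  moreover have "ennreal (sqrt 2) \<le> 2"
    using ennreal_leI[of "sqrt 2" 2] by (simp add: sqrt2_less_2 less_imp_le)
  ultimately show ?thesis by (simp only:)
qed

text \<open>A difference of two such averages is a combination of independent normals with nonzero
  coefficients, hence has a density and avoids 0 almost surely. There are finitely many
  pairs.\<close>

lemma AE_distinct_averages:
  assumes "S \<subseteq> I"
  shows "AE \<omega> in M. distinct_averages (\<lambda>i. \<xi> i \<omega>) S"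
proof -
  have fin: "finite S" using assms finite_I by (auto intro: finite_subset)
  have ne: "AE \<omega> in M. avg (\<lambda>i. \<xi> i \<omega>) P \<noteq> avg (\<lambda>i. \<xi> i \<omega>) Q"
    if PQ: "P \<subseteq> S" "Q \<subseteq> S" "P \<noteq> {}" "Q \<noteq> {}" "P \<inter> Q = {}" for P Q
  proof -
    have f: "finite P" "finite Q" using PQ fin by (auto intro: finite_subset)
    define c where "c i = (if i \<in> P then 1 / real (card P) else - (1 / real (card Q)))" for i
    have c: "c i \<noteq> 0" for i using f PQ by (simp add: c_def)
    have "distributed M lborel (\<lambda>\<omega>. 0 + c i * \<xi> i \<omega>) (normal_density (0 + c i * 0) (\<bar>c i\<bar> * \<sigma>))"
      if "i \<in> I" for i
      using that c sigma_pos normal by (intro normal_density_affine) auto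
    moreover have "indep_vars (\<lambda>_. borel) (\<lambda>i \<omega>. c i * \<xi> i \<omega>) (P \<union> Q)"
      using PQ assms by (intro indep_vars_compose2[OF indep_vars_subset[OF indep]]) auto
    ultimately have "distributed M lborel (\<lambda>\<omega>. \<Sum>i\<in>P \<union> Q. c i * \<xi> i \<omega>)
        (normal_density (\<Sum>i\<in>P \<union> Q. 0) (sqrt (\<Sum>i\<in>P \<union> Q. (\<bar>c i\<bar> * \<sigma>)\<^sup>2)))"
      using PQ assms f c sigma_pos by (intro sum_indep_normal) auto
    from distributed_AE2[OF this, of "\<lambda>x. x \<noteq> 0"]
    have "AE \<omega> in M. (\<Sum>i\<in>P \<union> Q. c i * \<xi> i \<omega>) \<noteq> 0"
      using AE_lborel_singleton[of "0::real"] by (auto elim!: AE_mp)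
    moreover have "(\<Sum>i\<in>P \<union> Q. c i * \<xi> i \<omega>) = avg (\<lambda>i. \<xi> i \<omega>) P - avg (\<lambda>i. \<xi> i \<omega>) Q" for \<omega>
    proof -
      have "(\<Sum>i\<in>P. c i * \<xi> i \<omega>) = avg (\<lambda>i. \<xi> i \<omega>) P"
        by (simp add: c_def avg_def sum_divide_distrib)
      moreover have "(\<Sum>i\<in>Q. c i * \<xi> i \<omega>) = (\<Sum>i\<in>Q. - (\<xi> i \<omega> / real (card Q)))"
        using PQ(5) by (intro sum.cong) (auto simp: c_def)
      ultimately show ?thesis using f PQ(5)
        by (simp add: sum.union_disjoint sum_negf avg_def sum_divide_distrib)
    qed
    ultimately show ?thesis by simp
  qed
  let ?A = "{(P, Q). P \<subseteq> S \<and> Q \<subseteq> S \<and> P \<noteq> {} \<and> Q \<noteq> {} \<and> P \<inter> Q = {}}"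
  have "finite ?A" by (rule finite_subset[of _ "Pow S \<times> Pow S"]) (use fin in auto)
  then have "AE \<omega> in M. \<forall>(P, Q)\<in>?A. avg (\<lambda>i. \<xi> i \<omega>) P \<noteq> avg (\<lambda>i. \<xi> i \<omega>) Q"
    using ne by (intro AE_finite_allI) auto
  then show ?thesis by (rule AE_mp) (auto simp: distinct_averages_def)
qed

lemma measurable_gain_xi:
  assumes "set xs \<subseteq> I"
  shows "(\<lambda>\<omega>. monotone_gain (\<lambda>i. \<xi> i \<omega>) xs) \<in> borel_measurable M"
proof -
  \<comment> \<open>Noise outside \<open>set xs\<close>, possibly not measurable, is replaced by 0,
    which leaves the gain along \<open>xs\<close> unchanged.\<close>
  have "(\<lambda>\<omega>. \<lambda>i. if i \<in> set xs then \<xi> i \<omega> else 0) \<in> borel_measurable M"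
  proof (rule measurable_coordinatewise_then_product)
    show "(\<lambda>\<omega>. if i \<in> set xs then \<xi> i \<omega> else 0) \<in> borel_measurable M" for i
      using assms measurable_xi[of i] by (cases "i \<in> set xs") auto
  qed
  from measurable_compose[OF this borel_measurable_gain[of xs]]
  have "(\<lambda>\<omega>. monotone_gain (\<lambda>i. if i \<in> set xs then \<xi> i \<omega> else 0) xs) \<in> borel_measurable M" .
  moreover have "monotone_gain (\<lambda>i. if i \<in> set xs then \<xi> i \<omega> else 0) xs = monotone_gain (\<lambda>i. \<xi> i \<omega>) xs" for \<omega>
    by (rule gain_cong) auto
  ultimately show ?thesis by simp
qed

lemma nn_integral_exp_gain_permute:
  assumes "distinct xs" "distinct ys" "set xs = set ys" "set xs \<subseteq> I"
  shows "(\<integral>\<^sup>+\<omega>. exp (s * monotone_gain (\<lambda>i. \<xi> i \<omega>) xs) \<partial>M)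
       = (\<integral>\<^sup>+\<omega>. exp (s * monotone_gain (\<lambda>i. \<xi> i \<omega>) ys) \<partial>M)"
proof -
  obtain p where p: "p permutes set xs" "ys = map p xs"
    using list_permutation_exists[OF assms(1-3)] .
  have d: "distr M borel (\<xi> i) = density lborel (normal_density 0 \<sigma>)" if "i \<in> I" for i
    using distributed_distr_eq_density[OF normal[OF that]] by (simp cong: distr_cong)
  have "(\<integral>\<^sup>+\<omega>. exp (s * monotone_gain (\<lambda>i. \<xi> i \<omega>) xs) \<partial>M)
      = (\<integral>\<^sup>+\<omega>. exp (s * monotone_gain (\<lambda>i. \<xi> (p i) \<omega>) xs) \<partial>M)"
  proof (rule nn_integral_indep_same_marginals[where S = "set xs" and \<eta> = "\<lambda>i. \<xi> (p i)"])
    show "indep_vars (\<lambda>_. borel) \<xi> (set xs)"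
      using indep assms(4) by (rule indep_vars_subset)
    then show "indep_vars (\<lambda>_. borel) (\<lambda>i. \<xi> (p i)) (set xs)"
      by (rule indep_vars_borel_reindex) (use p(1) in \<open>simp_all add: permutes_image permutes_inj_on\<close>)
    show "distr M borel (\<xi> i) = distr M borel (\<xi> (p i))" if "i \<in> set xs" for i
      using that permutes_in_image[OF p(1), of i] assms(4) by (auto simp: d subset_iff)
  qed (auto cong: gain_cong)
  also have "\<dots> = (\<integral>\<^sup>+\<omega>. exp (s * monotone_gain (\<lambda>i. \<xi> i \<omega>) ys) \<partial>M)"
    using p by (simp add: gain_map permutes_inj comp_def)
  finally show ?thesis .
qed

text \<open>By exchangeability all orderings have the same moment, so \<open>fact k\<close> copies
  of it, with \<open>k = length xs\<close>, form the sum over orderings. In the bounding sum over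
  fixed partitions the blocks are disjoint, hence independent, and each contributes at most
  \<open>2 * fact (card P - 1)\<close>. The total is at most \<open>fact (k + 1)\<close>.\<close>

lemma nn_integral_exp_gain_le:
  assumes "distinct xs" "set xs \<subseteq> I"
  shows "(\<integral>\<^sup>+\<omega>. exp (1 / (4 * \<sigma>\<^sup>2) * monotone_gain (\<lambda>i. \<xi> i \<omega>) xs) \<partial>M) \<le> ennreal (real (length xs) + 1)"
proof -
  define s where "s = 1 / (4 * \<sigma>\<^sup>2)"
  define S where "S = set xs"
  have S: "finite S" "S \<subseteq> I" "card S = length xs"
    using assms by (auto simp: S_def distinct_card)
  have s: "s \<ge> 0" by (simp add: s_def)
  let ?E = "\<lambda>xs. \<integral>\<^sup>+\<omega>. exp (s * monotone_gain (\<lambda>i. \<xi> i \<omega>) xs) \<partial>M"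
  have "?E xs * ennreal (fact (length xs)) = (\<Sum>ys\<in>permutations_of_set S. ?E xs)"
  proof -
    have "ennreal (fact (length xs)) = of_nat (card (permutations_of_set S))"
      using S by (simp add: ennreal_of_nat_eq_real_of_nat)
    then show ?thesis by (simp add: mult.commute)
  qed
  also have "\<dots> = (\<Sum>ys\<in>permutations_of_set S. ?E ys)"
    using assms by (intro sum.cong refl nn_integral_exp_gain_permute) (auto simp: permutations_of_set_def S_def)
  also have "\<dots> = (\<integral>\<^sup>+\<omega>. (\<Sum>ys\<in>permutations_of_set S. exp (s * monotone_gain (\<lambda>i. \<xi> i \<omega>) ys)) \<partial>M)"
  proof (subst nn_integral_sum[symmetric])
    fix ys assume "ys \<in> permutations_of_set S"
    then have [measurable]: "(\<lambda>\<omega>. monotone_gain (\<lambda>i. \<xi> i \<omega>) ys) \<in> borel_measurable M"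
      using S(2) by (intro measurable_gain_xi) (auto simp: permutations_of_set_def)
    show "(\<lambda>\<omega>. ennreal (exp (s * monotone_gain (\<lambda>i. \<xi> i \<omega>) ys))) \<in> borel_measurable M"
      by measurable
  qed (simp add: sum_ennreal)
  also have "\<dots> \<le> (\<integral>\<^sup>+\<omega>. (\<Sum>X\<in>{X. partition_on S X}. \<Prod>P\<in>X. block_weight s (\<lambda>i. \<xi> i \<omega>) P) \<partial>M)"
    using AE_distinct_averages[OF S(2)]
    by (intro nn_integral_mono_AE, elim AE_mp)
      (intro AE_I2 impI ennreal_leI sum_permutations_exp_gain_le S s)
  also have "\<dots> = (\<integral>\<^sup>+\<omega>. (\<Sum>X\<in>{X. partition_on S X}. \<Prod>P\<in>X. ennreal (block_weight s (\<lambda>i. \<xi> i \<omega>) P)) \<partial>M)"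
    by (intro nn_integral_cong, subst sum_ennreal[symmetric])
      (auto intro!: prod_nonneg block_weight_nonneg sum.cong prod_ennreal[symmetric])
  also have "\<dots> = (\<Sum>X\<in>{X. partition_on S X}. \<integral>\<^sup>+\<omega>. (\<Prod>P\<in>X. ennreal (block_weight s (\<lambda>i. \<xi> i \<omega>) P)) \<partial>M)"
  proof (rule nn_integral_sum)
    fix X assume X: "X \<in> {X. partition_on S X}"
    have [measurable]: "\<xi> i \<in> borel_measurable M" if "i \<in> P" "P \<in> X" for i P
      using X that S(2) by (intro measurable_xi) (auto dest: partition_onD1)
    show "(\<lambda>\<omega>. \<Prod>P\<in>X. ennreal (block_weight s (\<lambda>i. \<xi> i \<omega>) P)) \<in> borel_measurable M"
      unfolding block_weight_def by measurable
  qed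
  also have "\<dots> \<le> (\<Sum>X\<in>{X. partition_on S X}. ennreal (\<Prod>P\<in>X. 2 * fact (card P - 1)))"
  proof (rule sum_mono, clarify)
    fix X assume X: "partition_on S X"
    have sub: "P \<subseteq> I" "P \<noteq> {}" if "P \<in> X" for P
      using that X S(2) by (auto simp: partition_on_def)
    have "(\<integral>\<^sup>+\<omega>. (\<Prod>P\<in>X. ennreal (block_weight s (\<lambda>i. \<xi> i \<omega>) P)) \<partial>M)
        = (\<Prod>P\<in>X. \<integral>\<^sup>+\<omega>. ennreal (block_weight s (\<lambda>i. \<xi> i \<omega>) P) \<partial>M)"
    proof (rule nn_integral_prod_groups[where I = I and K = "\<lambda>P. P"])
      show "finite X" using S(1) X by (rule finite_elements)
      show "disjoint_family_on (\<lambda>P. P) X"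
        using partition_onD2[OF X] by (auto simp: disjoint_family_on_def disjoint_def)
      show "(\<lambda>g. ennreal (block_weight s g P)) \<in> borel_measurable borel" for P
        unfolding block_weight_def by measurable
    qed (use sub indep in \<open>auto simp: block_weight_def\<close>)
    also have "\<dots> \<le> (\<Prod>P\<in>X. ennreal (2 * fact (card P - 1)))"
    proof (rule prod_mono_ennreal)
      fix P assume P: "P \<in> X"
      have [measurable]: "\<xi> i \<in> borel_measurable M" if "i \<in> P" for i
        using that sub[OF P] by (intro measurable_xi) auto
      have "(\<integral>\<^sup>+\<omega>. ennreal (block_weight s (\<lambda>i. \<xi> i \<omega>) P) \<partial>M) =
          ennreal (fact (card P - 1)) * (\<integral>\<^sup>+\<omega>. exp (s * ((\<Sum>i\<in>P. \<xi> i \<omega>)\<^sup>2 / real (card P))) \<partial>M)"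
        unfolding block_weight_def by (subst nn_integral_cmult[symmetric]) (auto simp: ennreal_mult)
      also have "\<dots> \<le> ennreal (fact (card P - 1)) * 2"
        unfolding s_def by (intro mult_left_mono nn_integral_exp_block sub P) auto
      also have "\<dots> = ennreal (2 * fact (card P - 1))"
        by (simp add: ennreal_mult mult.commute)
      finally show "(\<integral>\<^sup>+\<omega>. ennreal (block_weight s (\<lambda>i. \<xi> i \<omega>) P) \<partial>M) \<le> ennreal (2 * fact (card P - 1))" .
    qed
    also have "\<dots> = ennreal (\<Prod>P\<in>X. 2 * fact (card P - 1))"
      by (rule prod_ennreal) simp
    finally show "(\<integral>\<^sup>+\<omega>. (\<Prod>P\<in>X. ennreal (block_weight s (\<lambda>i. \<xi> i \<omega>) P)) \<partial>M)
        \<le> ennreal (\<Prod>P\<in>X. 2 * fact (card P - 1))" .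
  qed
  also have "\<dots> = ennreal (\<Sum>X\<in>{X. partition_on S X}. \<Prod>P\<in>X. 2 * fact (card P - 1))"
    by (rule sum_ennreal) (auto intro!: prod_nonneg)
  also have "\<dots> \<le> ennreal (fact (card S + 1))"
    by (intro ennreal_leI sum_partitions_fact_le S)
  also have "\<dots> = ennreal (real (length xs) + 1) * ennreal (fact (length xs))"
    using S(3) by (simp add: ennreal_mult[symmetric] algebra_simps)
  finally have "?E xs * ennreal (fact (length xs)) \<le> ennreal (real (length xs) + 1) * ennreal (fact (length xs))" .
  then show ?thesis
    unfolding s_def by (simp add: mult.commute[of _ "ennreal (fact _)"] ennreal_mult_le_mult_iff)
qed

end

section \<open>Convex sequences on a piece\<close>

text \<open>Here \<open>a\<close> is a candidate for the position of the minimum; reversal of the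
  part before it turns antitone into sorted. Summing over \<open>a\<close> replaces the random
  position, so that expectations can be taken term by term.\<close>

definition convex_gain_bound :: "real \<Rightarrow> (nat \<Rightarrow> real) \<Rightarrow> nat set \<Rightarrow> real" where
  "convex_gain_bound s g T = (\<Sum>a\<in>T. exp (s * monotone_gain g (rev (sorted_list_of_set {i \<in> T. i < a})))
     * exp (s * monotone_gain g (sorted_list_of_set {i \<in> T. a \<le> i})))"

lemma convex_gain_bound_nonneg: "convex_gain_bound s g T \<ge> 0"
  unfolding convex_gain_bound_def by (intro sum_nonneg) simp

text \<open>A convex \<open>w\<close> falls up to a minimiser and rises after it, so the term of
  that minimiser alone suffices. Convexity is required over all triples of \<open>T\<close> in
  cross-multiplied form, which also covers gaps in \<open>T\<close>.\<close>

lemma exp_le_convex_gain_bound: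
  fixes w x g :: "nat \<Rightarrow> real"
  assumes "finite T" "T \<noteq> {}" "s \<ge> 0" and x: "strict_mono_on T x"
    and convex: "\<And>i k l. i \<in> T \<Longrightarrow> k \<in> T \<Longrightarrow> l \<in> T \<Longrightarrow> i < k \<Longrightarrow> k < l \<Longrightarrow>
      (w k - w i) * (x l - x k) \<le> (w l - w k) * (x k - x i)"
  shows "exp (s * (\<Sum>i\<in>T. 2 * g i * w i - (w i)\<^sup>2)) \<le> convex_gain_bound s g T"
proof -
  obtain a where a: "a \<in> T" "\<And>i. i \<in> T \<Longrightarrow> w a \<le> w i"
    using arg_min_if_finite[OF assms(1,2), of w] by (intro that[of "arg_min_on w T"]) (auto simp: not_less)
  have xless: "x i < x k" if "i \<in> T" "k \<in> T" "i < k" for i k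
    using strict_mono_onD[OF x] that by blast
  \<comment> \<open>The slope from \<open>k\<close> to the minimiser \<open>a\<close> is
    nonpositive, hence so is the earlier slope from \<open>i\<close> to \<open>k\<close>.\<close>
  have desc: "w k \<le> w i" if ik: "i \<in> T" "k \<in> T" "i < k" "k < a" for i k
  proof -
    have "(w k - w i) * (x a - x k) \<le> (w a - w k) * (x k - x i)"
      using ik a by (intro convex) auto
    also have "\<dots> \<le> 0" using a(2)[of k] xless[of i k] ik by (intro mult_nonpos_nonneg) auto
    finally show ?thesis using xless[of k a] ik a by (simp add: mult_le_0_iff)
  qed
  have asc: "w i \<le> w k" if ik: "i \<in> T" "k \<in> T" "i < k" "a \<le> i" for i k
  proof (cases "i = a")
    case True
    then show ?thesis using a ik by simp
  next
    case False
    have "0 \<le> (w i - w a) * (x k - x i)" using a(2)[of i] xless[of i k] ik by simp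
    also have "\<dots> \<le> (w k - w i) * (x i - x a)"
      using ik a False by (intro convex) auto
    finally show ?thesis using xless[of a i] ik a False by (simp add: zero_le_mult_iff)
  qed
  define L where "L = rev (sorted_list_of_set {i \<in> T. i < a})"
  define R where "R = sorted_list_of_set {i \<in> T. a \<le> i}"
  have sL: "set L = {i \<in> T. i < a}" "distinct L" and sR: "set R = {i \<in> T. a \<le> i}" "distinct R"
    using assms(1) by (auto simp: L_def R_def)
  have "sorted (map w L)"
    unfolding sorted_map L_def sorted_wrt_rev
  proof (rule sorted_wrt_mono_rel[of _ "(<)"])
    show "sorted_wrt (<) (sorted_list_of_set {i \<in> T. i < a})" by simp
  qed (use assms(1) in \<open>auto intro: desc\<close>)
  moreover have "sorted (map w R)"
    unfolding sorted_map R_def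
  proof (rule sorted_wrt_mono_rel[of _ "(<)"])
    show "sorted_wrt (<) (sorted_list_of_set {i \<in> T. a \<le> i})" by simp
  qed (use assms(1) in \<open>auto intro: asc\<close>)
  ultimately have le: "(\<Sum>i\<leftarrow>L. 2 * g i * w i - (w i)\<^sup>2) + (\<Sum>i\<leftarrow>R. 2 * g i * w i - (w i)\<^sup>2)
      \<le> monotone_gain g L + monotone_gain g R"
    by (intro add_mono gain_upper)
  have "T = set L \<union> set R" "set L \<inter> set R = {}" using sL sR by auto
  then have "(\<Sum>i\<in>T. 2 * g i * w i - (w i)\<^sup>2)
      = (\<Sum>i\<leftarrow>L. 2 * g i * w i - (w i)\<^sup>2) + (\<Sum>i\<leftarrow>R. 2 * g i * w i - (w i)\<^sup>2)"
    using sL(2) sR(2) by (simp add: sum_list_distinct_conv_sum_set sum.union_disjoint)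
  then have "exp (s * (\<Sum>i\<in>T. 2 * g i * w i - (w i)\<^sup>2)) \<le> exp (s * monotone_gain g L) * exp (s * monotone_gain g R)"
    using mult_left_mono[OF le assms(3)] by (simp add: exp_add[symmetric] algebra_simps)
  also have "\<dots> \<le> convex_gain_bound s g T"
    unfolding convex_gain_bound_def L_def R_def
    by (rule member_le_sum[OF a(1), where f = "\<lambda>a. exp (s * monotone_gain g (rev (sorted_list_of_set {i \<in> T. i < a})))
     * exp (s * monotone_gain g (sorted_list_of_set {i \<in> T. a \<le> i}))"]) (use assms(1) in auto)
  finally show ?thesis .
qed

lemma borel_measurable_convex_gain_bound [measurable]:
  "(\<lambda>g. convex_gain_bound s g T) \<in> borel_measurable borel"
  unfolding convex_gain_bound_def by measurable

lemma convex_gain_bound_cong: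
  assumes "finite T" "\<And>i. i \<in> T \<Longrightarrow> g i = h i"
  shows "convex_gain_bound s g T = convex_gain_bound s h T"
proof -
  have "monotone_gain g (rev (sorted_list_of_set {i \<in> T. i < a})) = monotone_gain h (rev (sorted_list_of_set {i \<in> T. i < a}))"
    "monotone_gain g (sorted_list_of_set {i \<in> T. a \<le> i}) = monotone_gain h (sorted_list_of_set {i \<in> T. a \<le> i})" for a
    using assms by (auto intro!: gain_cong)
  then show ?thesis by (simp add: convex_gain_bound_def)
qed

text \<open>AM-GM turns the product of the bounds over the pieces into the logarithmic penalty.\<close>

lemma prod_card_le:
  assumes "finite J" "J \<noteq> {}" and "\<And>j. j \<in> J \<Longrightarrow> real (c j) > 0"
    and n: "(\<Sum>j\<in>J. real (c j)) = n"
  shows "(\<Prod>j\<in>J. 2 * real (c j) ^ 4) \<le> 2 * exp (- 4) * exp (4 * real (card J) * ln (exp 1 * n / real (card J)))"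
proof -
  define q where "q = real (card J)"
  obtain k where k: "card J = Suc k" using assms(1,2) by (metis card_0_eq not0_implies_Suc)
  then have q: "q \<ge> 1" by (simp add: q_def)
  have npos: "n > 0" using assms by (auto simp: n[symmetric] intro!: sum_pos)
  \<comment> \<open>\<open>ln\<close> lies below its tangent at the mean piece size
    \<open>n / q\<close>; in the sum over the pieces the linear terms cancel.\<close>
  have term_le: "ln (real (c j)) \<le> ln (n / q) + real (c j) * q / n - 1" if "j \<in> J" for j
  proof -
    have "ln (real (c j) / (n / q)) \<le> real (c j) / (n / q) - 1"
      using assms(3)[OF that] npos q by (intro ln_le_minus_one) auto
    then show ?thesis using assms(3)[OF that] npos q by (simp add: ln_div ln_mult)
  qed
  have "(\<Sum>j\<in>J. ln (real (c j))) \<le> (\<Sum>j\<in>J. ln (n / q) + real (c j) * q / n - 1)"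
    by (intro sum_mono term_le)
  also have "\<dots> = q * ln (n / q) + (\<Sum>j\<in>J. real (c j)) * q / n - q"
    by (simp add: sum.distrib sum_subtractf q_def sum_distrib_right sum_divide_distrib)
  also have "\<dots> = q * ln (n / q)"
    using npos by (simp add: n)
  finally have sum_le: "(\<Sum>j\<in>J. ln (real (c j))) \<le> q * ln (n / q)" .
  have "(\<Prod>j\<in>J. 2 * real (c j) ^ 4) = 2 ^ card J * (\<Prod>j\<in>J. exp (4 * ln (real (c j))))"
  proof -
    have "real (c j) ^ 4 = exp (4 * ln (real (c j)))" if "j \<in> J" for j
      using assms(3)[OF that] exp_of_nat_mult[of 4 "ln (real (c j))"] by simp
    then show ?thesis by (simp add: prod.distrib)
  qed
  also have "\<dots> = 2 ^ card J * exp (4 * (\<Sum>j\<in>J. ln (real (c j))))"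
    by (simp add: exp_sum assms(1) sum_distrib_left)
  also have "\<dots> \<le> 2 ^ card J * exp (4 * (q * ln (n / q)))"
    using sum_le by simp
  also have "\<dots> \<le> (2 * exp (- 4) * exp (4 * q)) * exp (4 * (q * ln (n / q)))"
  proof (rule mult_right_mono)
    \<comment> \<open>Only \<open>k = q - 1\<close> of the factors 2 are raised to
      \<open>exp 4\<close>, so \<open>2 * exp (- 4)\<close> remains as slack for the final
      probability bound. The factor \<open>exp (4 * q)\<close> supplies the \<open>exp 1\<close>
      inside the logarithm.\<close>
    have "(2 :: real) \<le> exp 4" using exp_ge_add_one_self[of "4::real"] by simp
    then have "(2 :: real) ^ k \<le> exp 4 ^ k" by (intro power_mono) auto
    also have "\<dots> = exp (- 4) * exp (4 * q)"
      by (simp add: exp_of_nat2_mult[symmetric] q_def k exp_add[symmetric])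
    finally show "2 ^ card J \<le> 2 * exp (- 4) * exp (4 * q)" by (simp add: k)
  qed simp
  also have "\<dots> = 2 * exp (- 4) * exp (4 * q * ln (exp 1 * n / q))"
  proof -
    have "ln (exp 1 * n / q) = 1 + ln (n / q)"
      using npos q by (simp add: ln_mult ln_div)
    then show ?thesis by (simp add: mult.assoc exp_add[symmetric] algebra_simps)
  qed
  finally show ?thesis by (simp add: q_def)
qed

context gaussian_noise
begin

text \<open>The parts on the two sides of \<open>a\<close> are disjoint, hence independent, and
  contribute at most \<open>m\<close> and \<open>2 * m\<close>; there are \<open>m\<close>
  positions.\<close>

lemma nn_integral_convex_gain_bound_le:
  assumes "T \<subseteq> I" "T \<noteq> {}"
  shows "(\<integral>\<^sup>+\<omega>. convex_gain_bound (1 / (4 * \<sigma>\<^sup>2)) (\<lambda>i. \<xi> i \<omega>) T \<partial>M) \<le> ennreal (2 * real (card T) ^ 4)"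
proof -
  define s where "s = 1 / (4 * \<sigma>\<^sup>2)"
  have fin: "finite T" using assms finite_I by (auto intro: finite_subset)
  define m where "m = card T"
  have m: "m \<ge> 1" using fin assms by (simp add: m_def Suc_le_eq card_gt_0_iff)
  define L where "L a = rev (sorted_list_of_set {i \<in> T. i < a})" for a
  define R where "R a = sorted_list_of_set {i \<in> T. a \<le> i}" for a
  have sL: "set (L a) = {i \<in> T. i < a}" "distinct (L a)" and sR: "set (R a) = {i \<in> T. a \<le> i}" "distinct (R a)" for a
    using fin by (auto simp: L_def R_def)
  have sub: "set (L a) \<subseteq> I" "set (R a) \<subseteq> I" for a using sL sR assms by auto
  let ?e = "\<lambda>xs \<omega>. ennreal (exp (s * monotone_gain (\<lambda>i. \<xi> i \<omega>) xs))"
  have [measurable]: "(\<lambda>\<omega>. monotone_gain (\<lambda>i. \<xi> i \<omega>) (L a)) \<in> borel_measurable M"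
    "(\<lambda>\<omega>. monotone_gain (\<lambda>i. \<xi> i \<omega>) (R a)) \<in> borel_measurable M" for a
    using sub by (auto intro!: measurable_gain_xi)
  have "(\<integral>\<^sup>+\<omega>. convex_gain_bound s (\<lambda>i. \<xi> i \<omega>) T \<partial>M) = (\<integral>\<^sup>+\<omega>. (\<Sum>a\<in>T. ?e (L a) \<omega> * ?e (R a) \<omega>) \<partial>M)"
    unfolding convex_gain_bound_def L_def R_def
    by (intro nn_integral_cong, subst sum_ennreal[symmetric]) (auto simp: ennreal_mult)
  also have "\<dots> = (\<Sum>a\<in>T. \<integral>\<^sup>+\<omega>. ?e (L a) \<omega> * ?e (R a) \<omega> \<partial>M)"
    by (rule nn_integral_sum) measurable
  also have "\<dots> \<le> (\<Sum>a\<in>T. ennreal (2 * real m ^ 2))"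
  proof (rule sum_mono)
    fix a assume a: "a \<in> T"
    let ?LR = "\<lambda>b. if b then L a else R a"
    have "(\<integral>\<^sup>+\<omega>. (\<Prod>b\<in>UNIV. ?e (?LR b) \<omega>) \<partial>M) = (\<Prod>b\<in>UNIV. \<integral>\<^sup>+\<omega>. ?e (?LR b) \<omega> \<partial>M)"
    proof (rule nn_integral_prod_groups[where I = I and K = "\<lambda>b. set (?LR b)"])
      show "disjoint_family_on (\<lambda>b. set (?LR b)) UNIV"
        using sL sR by (auto simp: disjoint_family_on_def)
      show "(\<lambda>g. ennreal (exp (s * monotone_gain g (?LR b)))) \<in> borel_measurable borel" for b
        by measurable
    qed (use indep sub in \<open>auto cong: gain_cong\<close>)
    then have "(\<integral>\<^sup>+\<omega>. ?e (L a) \<omega> * ?e (R a) \<omega> \<partial>M) = (\<integral>\<^sup>+\<omega>. ?e (L a) \<omega> \<partial>M) * (\<integral>\<^sup>+\<omega>. ?e (R a) \<omega> \<partial>M)"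
      by (simp add: UNIV_bool mult.commute)
    also have "\<dots> \<le> ennreal (real (length (L a)) + 1) * ennreal (real (length (R a)) + 1)"
      unfolding s_def by (intro mult_mono nn_integral_exp_gain_le sL sR sub) auto
    also have "\<dots> = ennreal ((real (length (L a)) + 1) * (real (length (R a)) + 1))"
      by (simp add: ennreal_mult)
    also have "\<dots> \<le> ennreal (2 * real m ^ 2)"
    proof (rule ennreal_leI)
      have "{i \<in> T. i < a} \<subset> T" using a by auto
      then have "length (L a) < m"
        using sL fin unfolding m_def by (metis distinct_card psubset_card_mono)
      moreover have "length (R a) \<le> m"
        using sR[of a] fin card_mono[of T "{i \<in> T. a \<le> i}"] distinct_card[of "R a"] by (auto simp: m_def)
      ultimately have "(real (length (L a)) + 1) * (real (length (R a)) + 1) \<le> real m * (2 * real m)"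
        using m by (intro mult_mono) auto
      then show "(real (length (L a)) + 1) * (real (length (R a)) + 1) \<le> 2 * real m ^ 2"
        by (simp add: power2_eq_square)
    qed
    finally show "(\<integral>\<^sup>+\<omega>. ?e (L a) \<omega> * ?e (R a) \<omega> \<partial>M) \<le> ennreal (2 * real m ^ 2)" .
  qed
  also have "\<dots> = ennreal (2 * real m ^ 3)"
  proof -
    have "2 * real m ^ 3 = real m * (2 * real m ^ 2)" by (simp add: power3_eq_cube power2_eq_square)
    then show ?thesis
      by (simp only: sum_constant m_def[symmetric] ennreal_of_nat_eq_real_of_nat) (simp add: ennreal_mult)
  qed
  \<comment> \<open>The exponent 4, times the 4 in \<open>4 * \<sigma>\<^sup>2\<close>, matches the
    constant 16 of the penalty.\<close>
  also have "\<dots> \<le> ennreal (2 * real m ^ 4)"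
    using m by (intro ennreal_leI mult_left_mono power_increasing) auto
  finally show ?thesis unfolding s_def m_def .
qed

end

section \<open>The projection onto the convex sequences\<close>

text \<open>Slopes between neighbours increase, so the slope \<open>d k\<close> just after
  \<open>k\<close> is at least the mean slope from \<open>i\<close> to \<open>k\<close> and at most
  the one from \<open>k\<close> to \<open>l\<close>.\<close>

lemma convex_seqs_three_points:
  assumes u: "u \<in> convex_seqs n x" and x: "strict_mono_on {1..n} x"
    and ikl: "1 \<le> i" "i < k" "k < l" "l \<le> n"
  shows "(u k - u i) * (x l - x k) \<le> (u l - u k) * (x k - x i)"
proof -
  define d where "d j = (u (j + 1) - u j) / (x (j + 1) - x j)" for j
  have xpos: "x (j + 1) - x j > 0" if "1 \<le> j" "j < n" for j
    using strict_mono_onD[OF x, of j "j + 1"] that by simp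
  have increment: "u (j + 1) - u j = d j * (x (j + 1) - x j)" if "1 \<le> j" "j < n" for j
    using xpos[OF that] by (simp add: d_def)
  have d_step: "d j \<le> d (j + 1)" if "1 \<le> j" "j + 1 < n" for j
  proof -
    have "j + 1 \<in> {2..n - 1}" using that by auto
    then show ?thesis using u unfolding convex_seqs_def d_def by fastforce
  qed
  have d_mono: "d j \<le> d j'" if "j \<le> j'" "1 \<le> j" "j' < n" for j j'
    using that
  proof (induction j' rule: dec_induct)
    case (step j')
    then show ?case using d_step[of j'] by simp
  qed simp
  have "u k - u i \<le> d k * (x k - x i)"
  proof -
    have "m \<le> k \<longrightarrow> u m - u i \<le> d k * (x m - x i)" if "i \<le> m" for m
      using that
    proof (induction m rule: dec_induct)
      case (step m)
      show ?case
      proof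
        assume m: "Suc m \<le> k"
        have "u (m + 1) - u m = d m * (x (m + 1) - x m)"
          using step.hyps ikl m by (intro increment) auto
        also have "\<dots> \<le> d k * (x (m + 1) - x m)"
          using d_mono[of m k] xpos[of m] step.hyps ikl m by (intro mult_right_mono) auto
        finally show "u (Suc m) - u i \<le> d k * (x (Suc m) - x i)"
          using step.IH m by (simp add: algebra_simps)
      qed
    qed simp
    then show ?thesis using ikl by auto
  qed
  then have "(u k - u i) * (x l - x k) \<le> d k * (x k - x i) * (x l - x k)"
    using strict_mono_onD[OF x, of k l] ikl by (intro mult_right_mono) auto
  also have "d k * (x l - x k) \<le> u l - u k"
  proof -
    have "m \<le> n \<longrightarrow> d k * (x m - x k) \<le> u m - u k" if "k \<le> m" for m
      using that
    proof (induction m rule: dec_induct)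
      case (step m)
      show ?case
      proof
        assume m: "Suc m \<le> n"
        have "d k * (x (m + 1) - x m) \<le> d m * (x (m + 1) - x m)"
          using d_mono[of k m] xpos[of m] step.hyps ikl m by (intro mult_right_mono) auto
        also have "\<dots> = u (m + 1) - u m"
          using step.hyps ikl m by (intro increment[symmetric]) auto
        finally show "d k * (x (Suc m) - x k) \<le> u (Suc m) - u k"
          using step.IH m by (simp add: algebra_simps)
      qed
    qed simp
    then show ?thesis using ikl by auto
  qed
  then have "d k * (x k - x i) * (x l - x k) \<le> (u l - u k) * (x k - x i)"
    using strict_mono_onD[OF x, of i k] ikl mult_right_mono[of "d k * (x l - x k)" "u l - u k" "x k - x i"]
    by (simp add: mult_ac)
  finally show ?thesis .
qed

lemma closed_convex_seqs: "closed (convex_seqs n x)"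
proof -
  have coord: "continuous_on UNIV (\<lambda>u :: nat \<Rightarrow> real. u i)" for i
    by (rule continuous_on_product_coordinates)
  have "convex_seqs n x = (\<Inter>i\<in>- {1..n}. {u. u i = undefined}) \<inter>
     (\<Inter>i\<in>{2..n - 1}. {u. (u i - u (i - 1)) * inverse (x i - x (i - 1)) \<le> (u (i + 1) - u i) * inverse (x (i + 1) - x i)})"
    by (auto simp: convex_seqs_def PiE_def extensional_def divide_inverse)
  also have "closed \<dots>"
    by (intro closed_Int closed_INT ballI closed_Collect_le closed_Collect_eq continuous_intros coord)
  finally show ?thesis .
qed

lemma convex_seqs_convex:
  assumes "u \<in> convex_seqs n x" "v \<in> convex_seqs n x" "0 \<le> c" "c \<le> 1"
  shows "(\<lambda>i\<in>{1..n}. v i + c * (u i - v i)) \<in> convex_seqs n x"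
proof -
  define z where "z = (\<lambda>i\<in>{1..n}. v i + c * (u i - v i))"
  have "(z i - z (i - 1)) / (x i - x (i - 1)) \<le> (z (i + 1) - z i) / (x (i + 1) - x i)"
    if i: "i \<in> {2..n - 1}" for i
  proof -
    have zi: "z i = v i + c * (u i - v i)" "z (i - 1) = v (i - 1) + c * (u (i - 1) - v (i - 1))"
      "z (i + 1) = v (i + 1) + c * (u (i + 1) - v (i + 1))"
      using i by (auto simp: z_def)
    have split: "(v j + c * (u j - v j) - (v k + c * (u k - v k))) / h
        = (1 - c) * ((v j - v k) / h) + c * ((u j - u k) / h)" for j k and h :: real
      by (simp add: divide_inverse algebra_simps)
    show ?thesis unfolding zi split
      using assms i by (intro add_mono mult_left_mono) (auto simp: convex_seqs_def)
  qed
  then show ?thesis by (simp add: convex_seqs_def z_def)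
qed

lemma convex_seqs_nonempty: "convex_seqs n x \<noteq> {}"
proof -
  have "(\<lambda>i\<in>{1..n}. 0) \<in> convex_seqs n x" by (auto simp: convex_seqs_def)
  then show ?thesis by blast
qed

text \<open>\<open>arg_min\<close> is a choice, so a minimiser must be shown to exist. Candidates no
  worse than \<open>v0\<close> lie in a product of intervals and singletons
  \<open>{undefined}\<close>, compact by Tychonoff.\<close>

lemma least_squares_is_arg_min:
  assumes "closed K" "K \<noteq> {}" "K \<subseteq> {1..n} \<rightarrow>\<^sub>E UNIV" "n \<ge> 1"
  shows "is_arg_min (\<lambda>v. scaled_norm_sq n (\<lambda>i. y i - v i)) (\<lambda>v. v \<in> K) (least_squares n K y)"
proof -
  let ?f = "\<lambda>v. scaled_norm_sq n (\<lambda>i. y i - v i)"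
  obtain v0 where v0: "v0 \<in> K" using assms(2) by blast
  have coord: "continuous_on A (\<lambda>u :: nat \<Rightarrow> real. u i)" for i A
    by (rule continuous_on_subset[OF continuous_on_product_coordinates]) simp
  have cont: "continuous_on A ?f" for A
    unfolding scaled_norm_sq_def by (intro continuous_intros coord)
  define r where "r = sqrt (real n * ?f v0)"
  define B where "B i = (if i \<in> {1..n} then {y i - r..y i + r} else {undefined})" for i :: nat
  have "compact (PiE UNIV B)"
  proof -
    have "compactin (product_topology (\<lambda>_ :: nat. euclidean :: real topology) UNIV) (PiE UNIV B)"
      by (subst compactin_PiE) (auto simp: B_def)
    then show ?thesis by (simp add: euclidean_product_topology)
  qed
  let ?C = "K \<inter> {v. ?f v \<le> ?f v0}"
  have "?C \<subseteq> PiE UNIV B"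
  proof
    fix v assume v: "v \<in> ?C"
    have "v i \<in> B i" for i
    proof (cases "i \<in> {1..n}")
      case True
      have "(y i - v i)\<^sup>2 \<le> (\<Sum>j=1..n. (y j - v j)\<^sup>2)"
        using True by (intro member_le_sum) auto
      also have "\<dots> = real n * ?f v" using assms(4) by (simp add: scaled_norm_sq_def)
      also have "\<dots> \<le> real n * ?f v0" using v by (intro mult_left_mono) auto
      finally have "\<bar>y i - v i\<bar> \<le> r" unfolding r_def by (intro real_le_rsqrt) simp
      with True show ?thesis by (auto simp: B_def abs_le_iff)
    next
      case False
      then show ?thesis using v assms(3) by (auto simp: B_def PiE_def extensional_def)
    qed
    then show "v \<in> PiE UNIV B" by auto
  qed
  moreover have "closed ?C"
    using assms(1) by (intro closed_Int closed_Collect_le cont continuous_on_const)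
  ultimately have "compact ?C"
    using closed_Int_compact[OF _ \<open>compact (PiE UNIV B)\<close>, of ?C] by (simp add: Int_absorb2)
  then obtain v where v: "v \<in> ?C" "\<And>w. w \<in> ?C \<Longrightarrow> ?f v \<le> ?f w"
    using continuous_attains_inf[OF _ _ cont, of ?C] v0 by blast
  then have "is_arg_min ?f (\<lambda>v. v \<in> K) v"
    unfolding is_arg_min_def by (auto simp: not_less) (meson linorder_not_le order_less_le_trans order_less_imp_le)
  then show ?thesis unfolding least_squares_def arg_min_def using someI[of "is_arg_min ?f (\<lambda>v. v \<in> K)"] by blast
qed

section \<open>Variational properties of the projection\<close>

locale convex_regression =
  fixes n :: nat and x :: "nat \<Rightarrow> real"
  assumes n_pos: "n \<ge> 1"
begin

abbreviation proj :: "(nat \<Rightarrow> real) \<Rightarrow> nat \<Rightarrow> real" where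
  "proj \<equiv> least_squares n (convex_seqs n x)"

lemma proj_arg_min:
  "is_arg_min (\<lambda>v. scaled_norm_sq n (\<lambda>i. y i - v i)) (\<lambda>v. v \<in> convex_seqs n x) (proj y)"
  using n_pos closed_convex_seqs convex_seqs_nonempty
  by (intro least_squares_is_arg_min) (auto simp: convex_seqs_def)

lemma proj_in: "proj y \<in> convex_seqs n x"
  using proj_arg_min by (simp add: is_arg_min_def)

text \<open>First-order optimality: were the inner product positive, a short step from the
  projection towards \<open>u\<close> would stay in the cone and reduce the distance.\<close>

lemma proj_variational:
  assumes "u \<in> convex_seqs n x"
  shows "(\<Sum>i=1..n. (y i - proj y i) * (u i - proj y i)) \<le> 0"
proof (rule ccontr)
  define A where "A = (\<Sum>i=1..n. (y i - proj y i) * (u i - proj y i))"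
  define B where "B = (\<Sum>i=1..n. (u i - proj y i)\<^sup>2)"
  assume "\<not> ?thesis"
  then have A: "A > 0" by (simp add: A_def)
  have B: "B \<ge> 0" by (simp add: B_def sum_nonneg)
  \<comment> \<open>This step length ensures \<open>c * B \<le> A\<close>, also for
    \<open>B = 0\<close>, whereas optimality demands \<open>2 * A \<le> c * B\<close>.\<close>
  define c where "c = A / (A + B)"
  have c: "c > 0" "c \<le> 1" "c * B \<le> A" using A B by (auto simp: c_def field_simps)
  let ?z = "\<lambda>i\<in>{1..n}. proj y i + c * (u i - proj y i)"
  have "scaled_norm_sq n (\<lambda>i. y i - proj y i) \<le> scaled_norm_sq n (\<lambda>i. y i - ?z i)"
    using proj_arg_min[of y] convex_seqs_convex[OF assms proj_in, of c y] c
    by (auto simp: is_arg_min_def not_less)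
  then have "(\<Sum>i=1..n. (y i - proj y i)\<^sup>2) \<le> (\<Sum>i=1..n. (y i - ?z i)\<^sup>2)"
    using n_pos by (simp add: scaled_norm_sq_def divide_le_cancel)
  also have "\<dots> = (\<Sum>i=1..n. (y i - proj y i)\<^sup>2 - 2 * c * ((y i - proj y i) * (u i - proj y i)) + c\<^sup>2 * (u i - proj y i)\<^sup>2)"
    by (intro sum.cong) (auto simp: power2_eq_square algebra_simps)
  also have "\<dots> = (\<Sum>i=1..n. (y i - proj y i)\<^sup>2) - 2 * c * A + c\<^sup>2 * B"
    by (simp add: sum.distrib sum_subtractf A_def B_def sum_distrib_left)
  finally have "c * (2 * A) \<le> c * (c * B)" by (simp add: power2_eq_square mult_ac)
  with c A show False by simp
qed

text \<open>The two variational inequalities, each tested at the other projection, are added up to a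
  nonnegative square. This gives continuity and thereby measurability of the estimator.\<close>

lemma proj_nonexpansive:
  "(\<Sum>i=1..n. (proj y i - proj y' i)\<^sup>2) \<le> (\<Sum>i=1..n. (y i - y' i)\<^sup>2)"
proof -
  have "(\<Sum>i=1..n. (proj y i - proj y' i)\<^sup>2) - (\<Sum>i=1..n. (y i - y' i)\<^sup>2)
      \<le> 2 * ((\<Sum>i=1..n. (y i - proj y i) * (proj y' i - proj y i)) + (\<Sum>i=1..n. (y' i - proj y' i) * (proj y i - proj y' i)))"
    unfolding sum.distrib[symmetric] sum_subtractf[symmetric] sum_distrib_left
  proof (rule sum_mono)
    fix i
    have "0 \<le> ((y i - y' i) - (proj y i - proj y' i))\<^sup>2" by simp
    then show "(proj y i - proj y' i)\<^sup>2 - (y i - y' i)\<^sup>2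
      \<le> 2 * ((y i - proj y i) * (proj y' i - proj y i) + (y' i - proj y' i) * (proj y i - proj y' i))"
      by (simp add: power2_eq_square algebra_simps)
  qed
  also have "\<dots> \<le> 0"
    using proj_variational[OF proj_in[of y'], of y] proj_variational[OF proj_in[of y], of y'] by simp
  finally show ?thesis by simp
qed

lemma continuous_on_proj:
  assumes "i \<in> {1..n}"
  shows "continuous_on UNIV (\<lambda>y. proj y i)"
proof -
  have "((\<lambda>y. proj y i) \<longlongrightarrow> proj y0 i) (at y0)" for y0
  proof (rule LIM_zero_cancel, rule Lim_null_comparison)
    have "norm (proj y i - proj y0 i) \<le> sqrt (\<Sum>j=1..n. (y j - y0 j)\<^sup>2)" for y
    proof -
      have "(proj y i - proj y0 i)\<^sup>2 \<le> (\<Sum>j=1..n. (proj y j - proj y0 j)\<^sup>2)"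
        using assms by (intro member_le_sum) auto
      also have "\<dots> \<le> (\<Sum>j=1..n. (y j - y0 j)\<^sup>2)" by (rule proj_nonexpansive)
      finally show ?thesis by (intro real_le_rsqrt) simp
    qed
    then show "\<forall>\<^sub>F y in at y0. norm (proj y i - proj y0 i) \<le> sqrt (\<Sum>j=1..n. (y j - y0 j)\<^sup>2)" by simp
    have "continuous_on UNIV (\<lambda>y. sqrt (\<Sum>j=1..n. (y j - y0 j)\<^sup>2))"
      by (intro continuous_intros continuous_on_product_coordinates)
    then have "((\<lambda>y. sqrt (\<Sum>j=1..n. (y j - y0 j)\<^sup>2)) \<longlongrightarrow> sqrt (\<Sum>j=1..n. (y0 j - y0 j)\<^sup>2)) (at y0)"
      unfolding continuous_on_def by blast
    then show "((\<lambda>y. sqrt (\<Sum>j=1..n. (y j - y0 j)\<^sup>2)) \<longlongrightarrow> 0) (at y0)" by simp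
  qed
  then show ?thesis by (simp add: continuous_on_def)
qed

lemma proj_local:
  assumes "\<And>i. i \<in> {1..n} \<Longrightarrow> y i = y' i"
  shows "proj y = proj y'"
proof -
  have "scaled_norm_sq n (\<lambda>i. y i - v i) = scaled_norm_sq n (\<lambda>i. y' i - v i)" for v
    using assms by (simp add: scaled_norm_sq_def)
  then show ?thesis by (simp add: least_squares_def)
qed

text \<open>Expanding squares gives an identity whose last term is the inner product from the
  variational inequality.\<close>

lemma proj_oracle:
  assumes "u \<in> convex_seqs n x" and y: "\<And>i. y i = \<mu> i + g i"
  shows "(\<Sum>i=1..n. (proj y i - \<mu> i)\<^sup>2) \<le> (\<Sum>i=1..n. (u i - \<mu> i)\<^sup>2)
    + (\<Sum>i=1..n. 2 * g i * (proj y i - u i) - (proj y i - u i)\<^sup>2)"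
proof -
  have "(\<Sum>i=1..n. (proj y i - \<mu> i)\<^sup>2) = (\<Sum>i=1..n. (u i - \<mu> i)\<^sup>2)
    + (\<Sum>i=1..n. 2 * g i * (proj y i - u i) - (proj y i - u i)\<^sup>2)
    + 2 * (\<Sum>i=1..n. (y i - proj y i) * (u i - proj y i))"
    unfolding sum.distrib[symmetric] sum_distrib_left
    by (intro sum.cong) (auto simp: y power2_eq_square algebra_simps)
  with proj_variational[OF assms(1), of y] show ?thesis by simp
qed

end

text \<open>Singletons form \<open>n\<close> pieces, so the least number exists and is at most
  \<open>n\<close>.\<close>

lemma num_pieces_properties:
  assumes "n \<ge> 1"
  shows "piecewise_affine n x u (num_pieces n x u)" "1 \<le> num_pieces n x u" "num_pieces n x u \<le> n"
proof -
  have "partition_on {1..n} ((\<lambda>i. {i}) ` {1..n})" by (rule partition_on_singletons)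
  then have "n \<ge> 1 \<and> piecewise_affine n x u n"
    using assms unfolding piecewise_affine_def
    by (intro conjI exI[of _ "\<lambda>_. 0"] exI[of _ "\<lambda>i. {i}"]) (auto simp: inj_on_def)
  then have "num_pieces n x u \<ge> 1 \<and> piecewise_affine n x u (num_pieces n x u)" "num_pieces n x u \<le> n"
    unfolding num_pieces_def by (rule LeastI, rule Least_le)
  then show "piecewise_affine n x u (num_pieces n x u)" "1 \<le> num_pieces n x u" "num_pieces n x u \<le> n"
    by auto
qed

section \<open>The oracle inequality\<close>

lemma scaled_norm_sq_nonneg: "scaled_norm_sq n v \<ge> 0"
  by (simp add: scaled_norm_sq_def sum_nonneg)

lemma partition_on_image_disjoint_family:
  assumes "inj_on T J" "partition_on A (T ` J)"
  shows "disjoint_family_on T J"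
  unfolding disjoint_family_on_def
proof (intro ballI impI)
  fix i j assume ij: "i \<in> J" "j \<in> J" "i \<noteq> j"
  then have "T i \<noteq> T j" using assms(1) by (simp add: inj_on_eq_iff)
  with ij show "T i \<inter> T j = {}"
    by (intro disjointD[OF partition_onD2[OF assms(2)]] imageI)
qed

locale gaussian_convex_regression = gaussian_noise M \<xi> "{1..n}" \<sigma> + convex_regression n x
  for M :: "'a measure" and \<xi> \<sigma> n x +
  fixes \<mu> :: "nat \<Rightarrow> real" and y :: "'a \<Rightarrow> nat \<Rightarrow> real"
  assumes x_mono: "strict_mono_on {1..n} x" and y_eq: "\<And>\<omega> i. y \<omega> i = \<mu> i + \<xi> i \<omega>"
begin

lemma measurable_loss [measurable]:
  "(\<lambda>\<omega>. scaled_norm_sq n (\<lambda>i. proj (y \<omega>) i - \<mu> i)) \<in> borel_measurable M"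
proof -
  \<comment> \<open>The noise is known to be measurable only on \<open>{1..n}\<close>, and the
    projection depends on no other coordinates.\<close>
  define y' where "y' \<omega> i = (if i \<in> {1..n} then y \<omega> i else 0)" for \<omega> i
  have "(\<lambda>\<omega>. y' \<omega> i) \<in> borel_measurable M" for i
  proof (cases "i \<in> {1..n}")
    case True
    then have "(\<lambda>\<omega>. \<mu> i + \<xi> i \<omega>) \<in> borel_measurable M"
      by (intro borel_measurable_add borel_measurable_const measurable_xi)
    then show ?thesis unfolding y'_def y_eq if_P[OF True] .
  next
    case False
    show ?thesis unfolding y'_def if_not_P[OF False] by (rule borel_measurable_const)
  qed
  then have y': "y' \<in> borel_measurable M" by (rule measurable_coordinatewise_then_product)
  have eq: "proj (y \<omega>) = proj (y' \<omega>)" for \<omega>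
    unfolding y'_def by (rule proj_local) (rule if_P[symmetric])
  have "(\<lambda>\<omega>. proj (y \<omega>) i) \<in> borel_measurable M" if "i \<in> {1..n}" for i
    unfolding eq using measurable_compose[OF y' borel_measurable_continuous_onI[OF continuous_on_proj[OF that]]] .
  then show ?thesis
    unfolding scaled_norm_sq_def
    by (intro borel_measurable_times borel_measurable_sum borel_measurable_power borel_measurable_diff borel_measurable_const)
qed

text \<open>Subtracting \<open>u\<close> shifts all slopes within a piece by the same
  \<open>a j\<close>, so the difference inherits convexity there from the estimator.\<close>

lemma exp_excess_le:
  assumes u: "u \<in> convex_seqs n x" and J: "finite J" "inj_on T J" "partition_on {1..n} (T ` J)"
    and affine: "\<And>j i l. j \<in> J \<Longrightarrow> i \<in> T j \<Longrightarrow> l \<in> T j \<Longrightarrow> u i = a j * (x i - x l) + u l"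
    and s: "s \<ge> 0"
  shows "exp (s * (\<Sum>i=1..n. 2 * \<xi> i \<omega> * (proj (y \<omega>) i - u i) - (proj (y \<omega>) i - u i)\<^sup>2))
    \<le> (\<Prod>j\<in>J. convex_gain_bound s (\<lambda>i. \<xi> i \<omega>) (T j))"
proof -
  define w where "w i = proj (y \<omega>) i - u i" for i
  have sub: "T j \<subseteq> {1..n}" "T j \<noteq> {}" if "j \<in> J" for j
    using J(3) that by (auto simp: partition_on_def)
  have fin: "finite (T j)" if "j \<in> J" for j using sub[OF that] by (auto intro: finite_subset)
  have un: "{1..n} = (\<Union>j\<in>J. T j)" using J(3) by (auto simp: partition_on_def)
  have dj: "T j \<inter> T j' = {}" if "j \<in> J" "j' \<in> J" "j \<noteq> j'" for j j'
    using partition_on_image_disjoint_family[OF J(2,3)] that by (auto simp: disjoint_family_on_def)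
  have "(\<Sum>i=1..n. 2 * \<xi> i \<omega> * w i - (w i)\<^sup>2) = (\<Sum>j\<in>J. \<Sum>i\<in>T j. 2 * \<xi> i \<omega> * w i - (w i)\<^sup>2)"
    unfolding un by (intro sum.UNION_disjoint J(1) ballI impI fin dj)
  then have "exp (s * (\<Sum>i=1..n. 2 * \<xi> i \<omega> * w i - (w i)\<^sup>2))
      = (\<Prod>j\<in>J. exp (s * (\<Sum>i\<in>T j. 2 * \<xi> i \<omega> * w i - (w i)\<^sup>2)))"
    using J(1) by (simp add: exp_sum sum_distrib_left)
  also have "\<dots> \<le> (\<Prod>j\<in>J. convex_gain_bound s (\<lambda>i. \<xi> i \<omega>) (T j))"
  proof (rule prod_mono, rule conjI)
    fix j assume j: "j \<in> J"
    show "exp (s * (\<Sum>i\<in>T j. 2 * \<xi> i \<omega> * w i - (w i)\<^sup>2)) \<le> convex_gain_bound s (\<lambda>i. \<xi> i \<omega>) (T j)"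
    proof (rule exp_le_convex_gain_bound[where x = x])
      show "strict_mono_on (T j) x" using x_mono sub[OF j] by (auto intro: monotone_on_subset)
      fix i k l assume ikl: "i \<in> T j" "k \<in> T j" "l \<in> T j" "i < k" "k < l"
      then have three: "(proj (y \<omega>) k - proj (y \<omega>) i) * (x l - x k) \<le> (proj (y \<omega>) l - proj (y \<omega>) k) * (x k - x i)"
        using sub[OF j] by (intro convex_seqs_three_points[OF proj_in x_mono]) auto
      have slopes: "w k - w i = proj (y \<omega>) k - proj (y \<omega>) i - a j * (x k - x i)"
        "w l - w k = proj (y \<omega>) l - proj (y \<omega>) k - a j * (x l - x k)"
        using affine[OF j ikl(2,1)] affine[OF j ikl(3,2)] by (simp_all add: w_def)
      show "(w k - w i) * (x l - x k) \<le> (w l - w k) * (x k - x i)"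
        using three unfolding slopes by (simp add: algebra_simps)
    qed (use fin[OF j] sub[OF j] s in auto)
  qed simp
  finally show ?thesis by (simp add: w_def)
qed

text \<open>Chernoff bound: on the bad event the scaled excess exceeds \<open>L + t\<close>, and the
  bound on its exponential factorises over the pieces. It holds for every real \<open>t\<close>, so
  \<open>t - 1\<close> can be inserted later.\<close>

lemma oracle_tail_bound:
  assumes u: "u \<in> convex_seqs n x"
  defines "q \<equiv> num_pieces n x u"
  shows "prob {\<omega> \<in> space M. scaled_norm_sq n (\<lambda>i. proj (y \<omega>) i - \<mu> i) >
      scaled_norm_sq n (\<lambda>i. u i - \<mu> i) + 16 * \<sigma>\<^sup>2 * real q / real n * ln (exp 1 * real n / real q)
      + 4 * \<sigma>\<^sup>2 * t / real n} \<le> 2 * exp (- 4) * exp (- t)" (is "prob ?A \<le> _")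
proof -
  define s where "s = 1 / (4 * \<sigma>\<^sup>2)"
  have s: "s > 0" using sigma_pos by (simp add: s_def)
  \<comment> \<open>The penalty multiplied by \<open>n / (4 * \<sigma>\<^sup>2)\<close>.\<close>
  define L where "L = 4 * real q * ln (exp 1 * real n / real q)"
  note qp = num_pieces_properties[OF n_pos, of x u, folded q_def]
  from qp(1) obtain a T where T: "inj_on T {1..q}" "partition_on {1..n} (T ` {1..q})"
    "\<And>j i l. j \<in> {1..q} \<Longrightarrow> i \<in> T j \<Longrightarrow> l \<in> T j \<Longrightarrow> u i = a j * (x i - x l) + u l"
    unfolding piecewise_affine_def by blast
  have sub: "T j \<subseteq> {1..n}" "T j \<noteq> {}" if "j \<in> {1..q}" for j
    using T(2) that by (auto simp: partition_on_def)
  have fin: "finite (T j)" if "j \<in> {1..q}" for j using sub[OF that] by (auto intro: finite_subset)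
  have dj: "disjoint_family_on T {1..q}"
    using T(1,2) by (rule partition_on_image_disjoint_family)
  let ?G = "\<lambda>j \<omega>. convex_gain_bound s (\<lambda>i. \<xi> i \<omega>) (T j)"
  \<comment> \<open>Markov's inequality in pointwise form: the normalised product dominates the
    indicator of the bad event.\<close>
  have large: "1 \<le> exp (- (L + t)) * (\<Prod>j\<in>{1..q}. ?G j \<omega>)" if "\<omega> \<in> ?A" for \<omega>
  proof -
    let ?Z = "\<Sum>i=1..n. 2 * \<xi> i \<omega> * (proj (y \<omega>) i - u i) - (proj (y \<omega>) i - u i)\<^sup>2"
    have "((\<Sum>i=1..n. (u i - \<mu> i)\<^sup>2) + 4 * \<sigma>\<^sup>2 * (L + t)) / real n < (\<Sum>i=1..n. (proj (y \<omega>) i - \<mu> i)\<^sup>2) / real n"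
      using that by (simp add: scaled_norm_sq_def L_def add_divide_distrib distrib_left mult_ac)
    then have "(\<Sum>i=1..n. (u i - \<mu> i)\<^sup>2) + 4 * \<sigma>\<^sup>2 * (L + t) < (\<Sum>i=1..n. (proj (y \<omega>) i - \<mu> i)\<^sup>2)"
      using n_pos by (simp add: divide_less_cancel)
    also have "\<dots> \<le> (\<Sum>i=1..n. (u i - \<mu> i)\<^sup>2) + ?Z"
      by (intro proj_oracle u y_eq)
    finally have "4 * \<sigma>\<^sup>2 * (L + t) < ?Z" by simp
    then have "L + t < s * ?Z" using sigma_pos by (simp add: s_def field_simps)
    then have "exp (L + t) \<le> exp (s * ?Z)" by simp
    also have "\<dots> \<le> (\<Prod>j\<in>{1..q}. ?G j \<omega>)"
      by (rule exp_excess_le[OF u finite_atLeastAtMost T less_imp_le[OF s]])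
    finally have "exp (- (L + t)) * exp (L + t) \<le> exp (- (L + t)) * (\<Prod>j\<in>{1..q}. ?G j \<omega>)"
      by (rule mult_left_mono) simp
    then show ?thesis by (simp only: mult_exp_exp) simp
  qed
  have "emeasure M ?A = (\<integral>\<^sup>+\<omega>. indicator ?A \<omega> \<partial>M)"
    by (subst nn_integral_indicator) measurable
  also have "\<dots> \<le> (\<integral>\<^sup>+\<omega>. ennreal (exp (- (L + t))) * (\<Prod>j\<in>{1..q}. ennreal (?G j \<omega>)) \<partial>M)"
  proof (rule nn_integral_mono)
    fix \<omega>
    have eq: "ennreal (exp (- (L + t)) * (\<Prod>j\<in>{1..q}. ?G j \<omega>)) = ennreal (exp (- (L + t))) * (\<Prod>j\<in>{1..q}. ennreal (?G j \<omega>))"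
      by (subst prod_ennreal) (auto simp: convex_gain_bound_nonneg prod_nonneg ennreal_mult)
    show "indicator ?A \<omega> \<le> ennreal (exp (- (L + t))) * (\<Prod>j\<in>{1..q}. ennreal (?G j \<omega>))"
    proof (cases "\<omega> \<in> ?A")
      case True
      then show ?thesis using ennreal_leI[OF large[OF True]] unfolding eq by simp
    qed simp
  qed
  also have "\<dots> = ennreal (exp (- (L + t))) * (\<integral>\<^sup>+\<omega>. (\<Prod>j\<in>{1..q}. ennreal (?G j \<omega>)) \<partial>M)"
  proof (rule nn_integral_cmult)
    have "(\<lambda>\<omega>. ennreal (?G j \<omega>)) \<in> borel_measurable M" if "j \<in> {1..q}" for j
    proof -
      have "(\<lambda>\<omega> i. if i \<in> {1..n} then \<xi> i \<omega> else 0) \<in> borel_measurable M"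
      proof (rule measurable_coordinatewise_then_product)
        show "(\<lambda>\<omega>. if i \<in> {1..n} then \<xi> i \<omega> else 0) \<in> borel_measurable M" for i
          using measurable_xi[of i] by (cases "i \<in> {1..n}") auto
      qed
      from measurable_compose[OF this borel_measurable_convex_gain_bound[of s "T j"]]
      have "(\<lambda>\<omega>. convex_gain_bound s (\<lambda>i. if i \<in> {1..n} then \<xi> i \<omega> else 0) (T j)) \<in> borel_measurable M" .
      moreover have "convex_gain_bound s (\<lambda>i. if i \<in> {1..n} then \<xi> i \<omega> else 0) (T j) = ?G j \<omega>" for \<omega>
        using sub[OF that] fin[OF that] by (intro convex_gain_bound_cong) auto
      ultimately show ?thesis by simp
    qed
    then show "(\<lambda>\<omega>. \<Prod>j\<in>{1..q}. ennreal (?G j \<omega>)) \<in> borel_measurable M"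
      by (intro borel_measurable_prod_ennreal) auto
  qed
  also have "(\<integral>\<^sup>+\<omega>. (\<Prod>j\<in>{1..q}. ennreal (?G j \<omega>)) \<partial>M) = (\<Prod>j\<in>{1..q}. \<integral>\<^sup>+\<omega>. ennreal (?G j \<omega>) \<partial>M)"
    using indep dj sub fin
    by (intro nn_integral_prod_groups[where I = "{1..n}" and K = T and H = "\<lambda>j g. ennreal (convex_gain_bound s g (T j))"])
      (auto cong: convex_gain_bound_cong)
  also have "\<dots> \<le> (\<Prod>j\<in>{1..q}. ennreal (2 * real (card (T j)) ^ 4))"
    using sub unfolding s_def by (intro prod_mono_ennreal nn_integral_convex_gain_bound_le) auto
  also have "\<dots> = ennreal (\<Prod>j\<in>{1..q}. 2 * real (card (T j)) ^ 4)"
    by (rule prod_ennreal) simp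
  also have "\<dots> \<le> ennreal (2 * exp (- 4) * exp L)"
  proof (rule ennreal_leI)
    have "(\<Sum>j\<in>{1..q}. card (T j)) = card {1..n}"
      using T(2) fin dj by (subst card_UN_disjoint[symmetric]) (auto simp: partition_on_def disjoint_family_on_def)
    then have "(\<Sum>j\<in>{1..q}. real (card (T j))) = real n"
      by (simp flip: of_nat_sum)
    moreover have "real (card (T j)) > 0" if "j \<in> {1..q}" for j
      using fin[OF that] sub[OF that] by (simp add: card_gt_0_iff)
    ultimately show "(\<Prod>j\<in>{1..q}. 2 * real (card (T j)) ^ 4) \<le> 2 * exp (- 4) * exp L"
      using prod_card_le[of "{1..q}" "\<lambda>j. card (T j)" "real n"] qp(2) by (simp add: L_def)
  qed
  also have "ennreal (exp (- (L + t))) * ennreal (2 * exp (- 4) * exp L) = ennreal (2 * exp (- 4) * exp (- t))"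
    by (simp add: ennreal_mult[symmetric] exp_add[symmetric] mult_ac)
  finally have "emeasure M ?A \<le> ennreal (2 * exp (- 4) * exp (- t))"
    by (simp add: mult_left_mono)
  then show ?thesis by (simp add: emeasure_eq_measure)
qed

end

theorem theorem4p3:
  fixes M :: "'a measure" and n :: nat and \<mu> x :: "nat \<Rightarrow> real" and \<sigma> t :: real
    and \<xi> :: "nat \<Rightarrow> 'a \<Rightarrow> real" and y \<mu>hat :: "'a \<Rightarrow> nat \<Rightarrow> real"
  assumes "prob_space M"
    and "n \<ge> 3"
    and "\<sigma> > 0"
    and "strict_mono_on {1..n} x"
    and "prob_space.indep_vars M (\<lambda>_. borel) \<xi> {1..n}"
    and "\<And>i. i \<in> {1..n} \<Longrightarrow> distributed M lborel (\<xi> i) (normal_density 0 \<sigma>)"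
    and "\<And>\<omega> i. y \<omega> i = \<mu> i + \<xi> i \<omega>"
    and "\<And>\<omega>. \<mu>hat \<omega> = least_squares n (convex_seqs n x) (y \<omega>)"
    and "t > 0"
  shows "measure M {\<omega> \<in> space M.
      scaled_norm_sq n (\<lambda>i. \<mu>hat \<omega> i - \<mu> i) \<le>
        (INF u\<in>convex_seqs n x.
           scaled_norm_sq n (\<lambda>i. u i - \<mu> i)
           + 16 * \<sigma>\<^sup>2 * real (num_pieces n x u) / real n
             * ln (exp 1 * real n / real (num_pieces n x u)))
        + 4 * \<sigma>\<^sup>2 * t / real n} > 1 - exp (- t)"
proof -
  interpret prob_space M by fact
  interpret gaussian_convex_regression M \<xi> \<sigma> n x \<mu> y
    using assms by unfold_locales auto
  define R where "R u = scaled_norm_sq n (\<lambda>i. u i - \<mu> i) + 16 * \<sigma>\<^sup>2 * real (num_pieces n x u) / real n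
    * ln (exp 1 * real n / real (num_pieces n x u))" for u
  define c where "c = (INF u\<in>convex_seqs n x. R u)"
  let ?loss = "\<lambda>\<omega>. scaled_norm_sq n (\<lambda>i. proj (y \<omega>) i - \<mu> i)"
  \<comment> \<open>Since the number of pieces is at most \<open>n\<close>, the logarithm is
    nonnegative; so the infimum is over a set bounded below.\<close>
  have "R u \<ge> 0" for u
  proof -
    note q = num_pieces_properties[OF n_pos, of x u]
    have "1 \<le> exp 1 * real n / real (num_pieces n x u)"
    proof -
      have "real (num_pieces n x u) \<le> 1 * real n" using q by simp
      also have "\<dots> \<le> exp 1 * real n" by (intro mult_right_mono) auto
      finally show ?thesis using q by simp
    qed
    then show ?thesis unfolding R_def
      by (intro add_nonneg_nonneg scaled_norm_sq_nonneg mult_nonneg_nonneg ln_ge_zero) auto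
  qed
  then have bdd: "bdd_below (R ` convex_seqs n x)" by (intro bdd_belowI2)
  \<comment> \<open>The tail bound at \<open>t - 1\<close> absorbs the error of a near-minimiser, since \<open>2 / e\<^sup>3 < 1\<close>.\<close>
  have "c < c + 4 * \<sigma>\<^sup>2 / real n" using sigma_pos n_pos by simp
  then obtain u where u: "u \<in> convex_seqs n x" "R u < c + 4 * \<sigma>\<^sup>2 / real n"
    unfolding c_def using cINF_less_iff[OF convex_seqs_nonempty bdd] by blast
  define A where "A = {\<omega> \<in> space M. ?loss \<omega> > R u + 4 * \<sigma>\<^sup>2 * (t - 1) / real n}"
  have A[measurable]: "A \<in> events" unfolding A_def by measurable
  have "prob A \<le> 2 * exp (- 4) * exp (- (t - 1))"
    unfolding A_def R_def by (rule oracle_tail_bound[OF u(1)])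
  also have "\<dots> = 2 * exp (- 3) * exp (- t)"
    by (simp add: exp_add[symmetric] mult.assoc)
  also have "\<dots> < 1 * exp (- t)"
  proof (rule mult_strict_right_mono)
    have "(4 :: real) \<le> exp 3" using exp_ge_add_one_self[of "3::real"] by simp
    then show "2 * exp (- 3) < (1 :: real)" by (simp add: exp_minus field_simps)
  qed simp
  finally have "1 - exp (- t) < prob (space M - A)" by (simp add: prob_compl)
  also have "\<dots> \<le> prob {\<omega> \<in> space M. ?loss \<omega> \<le> c + 4 * \<sigma>\<^sup>2 * t / real n}"
  proof (rule finite_measure_mono)
    \<comment> \<open>Lowering \<open>t\<close> by 1 gains
      \<open>4 * \<sigma>\<^sup>2 / real n\<close>, exactly the margin allowed to
      \<open>u\<close>.\<close>
    have "R u + 4 * \<sigma>\<^sup>2 * (t - 1) / real n \<le> c + 4 * \<sigma>\<^sup>2 * t / real n"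
      using u(2) by (simp add: right_diff_distrib diff_divide_distrib)
    then show "space M - A \<subseteq> {\<omega> \<in> space M. ?loss \<omega> \<le> c + 4 * \<sigma>\<^sup>2 * t / real n}"
      by (auto simp: A_def not_less)
  qed measurable
  finally show ?thesis by (simp add: c_def R_def assms(8))
qed

end
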